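(* A finite set of points $Z\subset\mathbb{P}^2_{\mathbb{C}}$ with $|Z|\leq 8$ does not admit unexpected curves (of any degree).
   Context: Work over $\mathbb{C}$. A finite set $Z\subset\mathbb{P}^2$ admits unexpected curves of degree $j\geq 2$ if, for a generic point $q\in\mathbb{P}^2$ (i.e. for $q$ in a nonempty Zariski open subset), $$h^0(\mathbb{P}^2,\mathcal{O}_{\mathbb{P}^2}(j)\otimes\mathcal{I}(Z+(j-1)q))>\max\left(0,\ h^0(\mathbb{P}^2,\mathcal{O}_{\mathbb{P}^2}(j)\otimes\mathcal{I}(Z))-\binom{j}{2}\right),$$ where $\mathcal{I}(Z)$ is the ideal sheaf of functions vanishing on $Z$ and $\mathcal{I}(Z+(j-1)q)$ is the ideal sheaf of functions vanishing on $Z$ and vanishing to order $j-1$ at $q$. *)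

theory Defs
  imports "HOL-Analysis.Analysis" "HOL-Library.Poly_Mapping"
begin

section \<open>The complex projective plane\<close>

typedef proj_plane = "{vec.span {v} | v :: complex ^ 3. v \<noteq> 0}"
  morphisms line_of Proj_plane
  by (rule exI[of _ "vec.span {1}"]) (auto intro!: exI[of _ "1 :: complex ^ 3"])

definition hcoords :: "proj_plane \<Rightarrow> (complex ^ 3) set" where
  "hcoords p = line_of p - {0}"


section \<open>Polynomials in three variables\<close>

text \<open>The variables are indexed by the three-element type \<^typ>\<open>3\<close>, as are the coordinates of
  \<^typ>\<open>complex ^ 3\<close>.\<close>

type_synonym poly3 = "(3 \<Rightarrow>\<^sub>0 nat) \<Rightarrow>\<^sub>0 complex"

definition poly3_scale :: "complex \<Rightarrow> poly3 \<Rightarrow> poly3" where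
  "poly3_scale c F = Poly_Mapping.single 0 c * F"

global_interpretation poly3: vector_space poly3_scale
  defines poly3_dim = poly3.dim
  by unfold_locales
    (simp_all add: poly3_scale_def single_add mult_single algebra_simps flip: mult.assoc)

definition poly3_eval :: "poly3 \<Rightarrow> complex ^ 3 \<Rightarrow> complex" where
  "poly3_eval F v =
     (\<Sum>m\<in>Poly_Mapping.keys F. Poly_Mapping.lookup F m * (\<Prod>i\<in>UNIV. (v $ i) ^ Poly_Mapping.lookup m i))"

definition homogeneous :: "nat \<Rightarrow> poly3 \<Rightarrow> bool" where
  "homogeneous d F \<longleftrightarrow>
     (\<forall>m\<in>Poly_Mapping.keys F. (\<Sum>i\<in>UNIV. Poly_Mapping.lookup m i) = d)"

text \<open>Formal partial derivative. If the exponent of the variable \<open>i\<close> in \<open>m\<close> is zero, the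
  difference of exponents is truncated, but then the coefficient of that term is zero.\<close>

definition partial_deriv :: "3 \<Rightarrow> poly3 \<Rightarrow> poly3" where
  "partial_deriv i F =
     (\<Sum>m\<in>Poly_Mapping.keys F.
        Poly_Mapping.single (m - Poly_Mapping.single i 1)
          (of_nat (Poly_Mapping.lookup m i) * Poly_Mapping.lookup F m))"


section \<open>Vanishing of forms at points of the plane\<close>

definition vanishes_at :: "poly3 \<Rightarrow> proj_plane \<Rightarrow> bool" where
  "vanishes_at F p \<longleftrightarrow> (\<forall>v\<in>hcoords p. poly3_eval F v = 0)"

text \<open>A form of degree \<open>d\<close> is a section of \<open>O(d)\<close>. On the affine chart \<open>x\<^sub>i = 1\<close> it
  becomes a function of the two remaining coordinates, and it vanishes to order at least \<open>m\<close> at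
  a point of the chart if all partial derivatives of order less than \<open>m\<close> in these two
  coordinates are zero there, i.e. if its germ lies in the \<open>m\<close>-th power of the maximal ideal.
  As \<open>x\<^sub>i\<close> is not differentiated, one may differentiate the form first and set \<open>x\<^sub>i = 1\<close>
  afterwards. The list \<open>ks\<close> contains the variables with respect to which one differentiates.\<close>

definition vanishes_to_order :: "nat \<Rightarrow> poly3 \<Rightarrow> proj_plane \<Rightarrow> bool" where
  "vanishes_to_order m F p \<longleftrightarrow>
     (\<forall>v\<in>hcoords p. \<forall>i. v $ i = 1 \<longrightarrow>
        (\<forall>ks. length ks < m \<and> i \<notin> set ks \<longrightarrow> poly3_eval (foldr partial_deriv ks F) v = 0))"


section \<open>Zariski topology\<close>

definition zariski_open :: "proj_plane set \<Rightarrow> bool" where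
  "zariski_open U \<longleftrightarrow>
     (\<exists>S. (\<forall>F\<in>S. \<exists>d. homogeneous d F) \<and> U = {p. \<exists>F\<in>S. \<not> vanishes_at F p})"

definition for_generic_point :: "(proj_plane \<Rightarrow> bool) \<Rightarrow> bool" where
  "for_generic_point P \<longleftrightarrow> (\<exists>U. zariski_open U \<and> U \<noteq> {} \<and> (\<forall>q\<in>U. P q))"


section \<open>Unexpected curves\<close>

text \<open>Global sections of \<open>O(j)\<close> are identified with forms of degree \<open>j\<close>; the sections of
  \<open>O(j) \<otimes> I(Z)\<close> and \<open>O(j) \<otimes> I(Z + m q)\<close> are then the following spaces of forms.\<close>

definition sections_through :: "nat \<Rightarrow> proj_plane set \<Rightarrow> poly3 set" where
  "sections_through j Z = {F. homogeneous j F \<and> (\<forall>p\<in>Z. vanishes_at F p)}"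

definition sections_through_mult ::
    "nat \<Rightarrow> proj_plane set \<Rightarrow> nat \<Rightarrow> proj_plane \<Rightarrow> poly3 set" where
  "sections_through_mult j Z m q = {F \<in> sections_through j Z. vanishes_to_order m F q}"

definition admits_unexpected_curves :: "proj_plane set \<Rightarrow> nat \<Rightarrow> bool" where
  "admits_unexpected_curves Z j \<longleftrightarrow>
     for_generic_point (\<lambda>q.
       int (poly3_dim (sections_through_mult j Z (j - 1) q)) >
         max 0 (int (poly3_dim (sections_through j Z)) - int (j choose 2)))"

end

theory Submission
  imports Defs "HOL-Computational_Algebra.Polynomial"
begin

text \<open>
  Let \<open>W\<^sub>q\<close> be the space of forms of degree \<open>j\<close> with a point of multiplicity \<open>j - 1\<close> at \<open>q\<close>. If a set
  \<open>X\<close> of points is separated by \<open>W\<^sub>q\<close> (each point has a form in \<open>W\<^sub>q\<close> that vanishes on the rest of \<open>X\<close>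
  but not there), then the \<open>j choose 2\<close> conditions at \<open>q\<close> stay independent on the forms through \<open>X\<close>:
  correct the Taylor monomials at \<open>q\<close> of order at most \<open>j - 2\<close> by the separating forms. So it suffices to
  take a subset \<open>X\<close> of \<open>Z\<close> that is separated by all forms of degree \<open>j\<close>, of maximal size but with at
  most \<open>2 j + 1\<close> points, and to separate it by \<open>W\<^sub>q\<close> for generic \<open>q\<close>. Separation is an open condition,
  hence one special \<open>q\<close> is enough.

  For \<open>j = 2\<close>, take \<open>q\<close> off some conic through \<open>X\<close>. If \<open>j \<ge> 3\<close> and some line \<open>L\<close> contains at least
  four points of \<open>X\<close>, then at most \<open>j\<close> points lie off \<open>L\<close> and at most \<open>j + 1\<close> on it, and products of a line
  with \<open>j - 1\<close> lines through \<open>q\<close> do the job. Otherwise enlarge \<open>X\<close> to seven (\<open>j = 3\<close>) or eight points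
  without four collinear ones. Some line \<open>L\<close> contains exactly two of them: for eight points by parity,
  for seven because the Fano plane does not embed in the complex projective plane. Choose \<open>q\<close> general on \<open>L\<close>.
  A point off \<open>L\<close> is separated from the others by the product of \<open>L\<close>, of \<open>j - 3\<close> lines through \<open>q\<close>, and of
  a conic through \<open>q\<close> and four points. Such a conic exists because \<open>L\<close> cannot be a component of a conic
  through five points off \<open>L\<close>, no four of them collinear.
\<close>

section \<open>Forms in three variables\<close>

lemma sum_keys_superset:
  assumes "finite A" "Poly_Mapping.keys F \<subseteq> A" "\<And>m. g m 0 = 0"
  shows "(\<Sum>m\<in>Poly_Mapping.keys F. g m (Poly_Mapping.lookup F m)) = (\<Sum>m\<in>A. g m (Poly_Mapping.lookup F m))"
  using assms by (intro sum.mono_neutral_left) (auto simp: in_keys_iff)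

text \<open>Evaluation and formal derivatives are both sums over the support of a polynomial. Over
  the union of two supports additivity becomes a termwise matter.\<close>

lemma sum_keys_add:
  fixes g :: "'a \<Rightarrow> 'b::comm_monoid_add \<Rightarrow> 'c::comm_monoid_add"
  assumes "\<And>m. g m 0 = 0" "\<And>m a b. g m (a + b) = g m a + g m b"
  shows "(\<Sum>m\<in>Poly_Mapping.keys (F + G). g m (Poly_Mapping.lookup (F + G) m)) =
    (\<Sum>m\<in>Poly_Mapping.keys F. g m (Poly_Mapping.lookup F m)) +
    (\<Sum>m\<in>Poly_Mapping.keys G. g m (Poly_Mapping.lookup G m))"
proof -
  let ?A = "Poly_Mapping.keys F \<union> Poly_Mapping.keys G"
  have fin: "finite ?A" by simp
  show ?thesis
    using sum_keys_superset[of ?A F g] sum_keys_superset[of ?A G g]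
      sum_keys_superset[of ?A "F + G" g] Poly_Mapping.keys_add[of F G] assms
    by (simp add: lookup_add sum.distrib)
qed

lemma poly3_eval_add: "poly3_eval (F + G) v = poly3_eval F v + poly3_eval G v"
  unfolding poly3_eval_def
  by (rule sum_keys_add[of "\<lambda>m a. a * (\<Prod>i\<in>UNIV. (v $ i) ^ Poly_Mapping.lookup m i)"])
     (auto simp: algebra_simps)

lemma poly3_eval_single:
  "poly3_eval (Poly_Mapping.single m a) v = a * (\<Prod>i\<in>UNIV. (v $ i) ^ Poly_Mapping.lookup m i)"
  unfolding poly3_eval_def by simp

lemma poly3_eval_zero [simp]: "poly3_eval 0 v = 0"
  unfolding poly3_eval_def by simp

lemma poly3_eval_sum: "poly3_eval (sum f A) v = (\<Sum>x\<in>A. poly3_eval (f x) v)"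
  by (induction A rule: infinite_finite_induct) (auto simp: poly3_eval_add)

lemma poly_mapping_eq_sum_single:
  "(\<Sum>m\<in>Poly_Mapping.keys F. Poly_Mapping.single m (Poly_Mapping.lookup F m)) = F"
proof (rule poly_mapping_eqI)
  fix k
  have "Poly_Mapping.lookup (\<Sum>m\<in>Poly_Mapping.keys F. Poly_Mapping.single m (Poly_Mapping.lookup F m)) k
      = (\<Sum>m\<in>Poly_Mapping.keys F. if m = k then Poly_Mapping.lookup F m else 0)"
    by (auto simp: lookup_sum lookup_single when_def intro!: sum.cong)
  then show "Poly_Mapping.lookup (\<Sum>m\<in>Poly_Mapping.keys F. Poly_Mapping.single m (Poly_Mapping.lookup F m)) k
      = Poly_Mapping.lookup F k"
    by (simp add: in_keys_iff)
qed

text \<open>Identities that are additive in \<open>F\<close> only have to be checked on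
  monomials.\<close>

lemma poly3_induct [case_names single add]:
  fixes F :: poly3
  assumes "\<And>m a. P (Poly_Mapping.single m a)" "\<And>F G. P F \<Longrightarrow> P G \<Longrightarrow> P (F + G)"
  shows "P F"
proof -
  have "P (\<Sum>m\<in>A. Poly_Mapping.single m (Poly_Mapping.lookup F m))" if "finite A" for A
    using that
  proof (induction A)
    case empty
    show ?case using assms(1)[of 0 0] by simp
  qed (auto intro!: assms)
  from this[of "Poly_Mapping.keys F"] show ?thesis
    by (simp add: poly_mapping_eq_sum_single)
qed

lemma poly3_eval_mult: "poly3_eval (F * G) v = poly3_eval F v * poly3_eval G v"
proof (induction F rule: poly3_induct)
  case (single m a)
  show ?case
    by (induction G rule: poly3_induct)
       (auto simp: mult_single poly3_eval_single poly3_eval_add lookup_add power_add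
          prod.distrib algebra_simps)
qed (auto simp: poly3_eval_add algebra_simps)

lemma poly3_eval_scale: "poly3_eval (poly3_scale c F) v = c * poly3_eval F v"
  by (simp add: poly3_scale_def poly3_eval_mult poly3_eval_single)

lemma poly3_eval_one [simp]: "poly3_eval 1 v = 1"
  using poly3_eval_single[of 0 1 v] by simp

lemma poly3_eval_power: "poly3_eval (F ^ n) v = poly3_eval F v ^ n"
  by (induction n) (auto simp: poly3_eval_mult)

section \<open>Formal derivatives\<close>

lemma partial_deriv_add: "partial_deriv k (F + G) = partial_deriv k F + partial_deriv k G"
  unfolding partial_deriv_def
  by (rule sum_keys_add[of "\<lambda>m a. Poly_Mapping.single (m - Poly_Mapping.single k 1)
          (of_nat (Poly_Mapping.lookup m k) * a)"])
     (auto simp: algebra_simps single_add)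

lemma partial_deriv_single:
  "partial_deriv k (Poly_Mapping.single m a) =
     Poly_Mapping.single (m - Poly_Mapping.single k 1) (of_nat (Poly_Mapping.lookup m k) * a)"
  unfolding partial_deriv_def by simp

lemma partial_deriv_mult:
  "partial_deriv k (F * G) = partial_deriv k F * G + F * partial_deriv k G"
proof (induction F rule: poly3_induct)
  case (single m a)
  show ?case
  proof (induction G rule: poly3_induct)
    case (single n b)
    \<comment> \<open>A zero exponent would be truncated by the subtraction, but then the
      coefficient is zero. A positive exponent lets the subtraction move past the sum.\<close>
    have 1: "Poly_Mapping.single (m + n - Poly_Mapping.single k 1) (of_nat (Poly_Mapping.lookup m k) * (a * b))
      = Poly_Mapping.single (m - Poly_Mapping.single k 1 + n) (of_nat (Poly_Mapping.lookup m k) * (a * b))"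
    proof (cases "Poly_Mapping.lookup m k = 0")
      case False
      then have "m + n - Poly_Mapping.single k 1 = m - Poly_Mapping.single k 1 + n"
        by (intro poly_mapping_eqI) (auto simp: lookup_add lookup_minus lookup_single when_def)
      then show ?thesis by simp
    qed simp
    have 2: "Poly_Mapping.single (m + n - Poly_Mapping.single k 1) (of_nat (Poly_Mapping.lookup n k) * (a * b))
      = Poly_Mapping.single (m + (n - Poly_Mapping.single k 1)) (of_nat (Poly_Mapping.lookup n k) * (a * b))"
    proof (cases "Poly_Mapping.lookup n k = 0")
      case False
      then have "m + n - Poly_Mapping.single k 1 = m + (n - Poly_Mapping.single k 1)"
        by (intro poly_mapping_eqI) (auto simp: lookup_add lookup_minus lookup_single when_def)
      then show ?thesis by simp
    qed simp
    show ?case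
      using 1 2 by (simp add: mult_single partial_deriv_single lookup_add single_add algebra_simps)
  qed (auto simp: partial_deriv_add algebra_simps)
qed (auto simp: partial_deriv_add algebra_simps)

lemma partial_deriv_zero [simp]: "partial_deriv k 0 = 0"
  by (simp add: partial_deriv_def)

lemma partial_deriv_scale: "partial_deriv k (poly3_scale c F) = poly3_scale c (partial_deriv k F)"
  by (simp add: poly3_scale_def partial_deriv_mult partial_deriv_single)

lemma partial_deriv_one [simp]: "partial_deriv k 1 = 0"
  using partial_deriv_single[of k 0 1] by simp

section \<open>Homogeneous polynomials\<close>

lemma homogeneous_add: "homogeneous d F \<Longrightarrow> homogeneous d G \<Longrightarrow> homogeneous d (F + G)"
  using Poly_Mapping.keys_add[of F G] unfolding homogeneous_def by blast

lemma homogeneous_zero [simp]: "homogeneous d 0"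
  by (simp add: homogeneous_def)

lemma homogeneous_mult:
  assumes "homogeneous d F" "homogeneous e G"
  shows "homogeneous (d + e) (F * G)"
  unfolding homogeneous_def
proof
  fix m assume "m \<in> Poly_Mapping.keys (F * G)"
  with keys_mult[of F G] obtain a b where "m = a + b" "a \<in> Poly_Mapping.keys F" "b \<in> Poly_Mapping.keys G"
    by blast
  then show "(\<Sum>i\<in>UNIV. Poly_Mapping.lookup m i) = d + e"
    using assms by (simp add: homogeneous_def lookup_add sum.distrib)
qed

lemma homogeneous_single:
  "(\<Sum>i\<in>UNIV. Poly_Mapping.lookup m i) = d \<Longrightarrow> homogeneous d (Poly_Mapping.single m a)"
  by (auto simp: homogeneous_def split: if_splits)

lemma homogeneous_scale: "homogeneous d F \<Longrightarrow> homogeneous d (poly3_scale c F)"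
  using homogeneous_mult[of 0 "Poly_Mapping.single 0 c" d F]
  by (simp add: poly3_scale_def homogeneous_single)

lemma homogeneous_sum: "(\<And>x. x \<in> A \<Longrightarrow> homogeneous d (f x)) \<Longrightarrow> homogeneous d (sum f A)"
  by (induction A rule: infinite_finite_induct) (auto simp: homogeneous_add)

lemma homogeneous_one: "homogeneous 0 1"
  using homogeneous_single[of 0 0 1] by simp

lemma homogeneous_power: "homogeneous d F \<Longrightarrow> homogeneous (n * d) (F ^ n)"
  by (induction n) (auto intro: homogeneous_one homogeneous_mult)

lemma poly3_eval_smult:
  assumes "homogeneous d F"
  shows "poly3_eval F (c *s v) = c ^ d * poly3_eval F v"
proof -
  have "poly3_eval F (c *s v) = (\<Sum>m\<in>Poly_Mapping.keys F. c ^ d *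
      (Poly_Mapping.lookup F m * (\<Prod>i\<in>UNIV. (v $ i) ^ Poly_Mapping.lookup m i)))"
    unfolding poly3_eval_def
  proof (rule sum.cong)
    fix m assume "m \<in> Poly_Mapping.keys F"
    then have "(\<Prod>i\<in>UNIV. c ^ Poly_Mapping.lookup m i) = c ^ d"
      using assms by (simp add: homogeneous_def flip: power_sum)
    then show "Poly_Mapping.lookup F m * (\<Prod>i\<in>UNIV. (c *s v) $ i ^ Poly_Mapping.lookup m i) =
         c ^ d * (Poly_Mapping.lookup F m * (\<Prod>i\<in>UNIV. (v $ i) ^ Poly_Mapping.lookup m i))"
      by (simp add: power_mult_distrib prod.distrib)
  qed simp
  then show ?thesis
    by (simp add: poly3_eval_def sum_distrib_left)
qed

text \<open>Substituting linear polynomials in \<open>t\<close> for the variables turns a form into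
  a univariate polynomial. This makes root counting available on lines.\<close>

lemma poly3_eval_on_line:
  assumes "homogeneous d F"
  shows "\<exists>P. degree P \<le> d \<and> (\<forall>t. poly3_eval F (u + t *s w) = poly P t)"
proof -
  define P where "P = (\<Sum>m\<in>Poly_Mapping.keys F. Polynomial.smult (Poly_Mapping.lookup F m)
       (\<Prod>i\<in>UNIV. [:u $ i, w $ i:] ^ Poly_Mapping.lookup m i))"
  have "degree P \<le> d"
    unfolding P_def
  proof (intro degree_sum_le)
    fix m assume m: "m \<in> Poly_Mapping.keys F"
    have "degree (\<Prod>i\<in>(UNIV :: 3 set). [:u $ i, w $ i:] ^ Poly_Mapping.lookup m i)
        \<le> (\<Sum>i\<in>UNIV. Poly_Mapping.lookup m i)"
    proof (rule order_trans[OF degree_prod_sum_le], simp, rule sum_mono)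
      fix i
      show "(degree \<circ> (\<lambda>i. [:u $ i, w $ i:] ^ Poly_Mapping.lookup m i)) i \<le> Poly_Mapping.lookup m i"
        using degree_power_le[of "[:u $ i, w $ i:]" "Poly_Mapping.lookup m i"]
        by (auto intro!: order_trans[OF degree_power_le] split: if_splits)
    qed
    then show "degree (Polynomial.smult (Poly_Mapping.lookup F m) (\<Prod>i\<in>UNIV. [:u $ i, w $ i:] ^ Poly_Mapping.lookup m i)) \<le> d"
      using m assms unfolding homogeneous_def by (auto intro: order_trans[OF degree_smult_le])
  qed simp
  moreover have "poly3_eval F (u + t *s w) = poly P t" for t
    unfolding P_def poly3_eval_def by (simp add: poly_sum poly_prod poly_power)
  ultimately show ?thesis by blast
qed

section \<open>Linear forms\<close>

definition lin :: "complex ^ 3 \<Rightarrow> poly3" where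
  "lin a = (\<Sum>i\<in>UNIV. Poly_Mapping.single (Poly_Mapping.single i 1) (a $ i))"

text \<open>Bilinear, without complex conjugation, so that \<open>dot a\<close> is the linear form
  with coefficient vector \<open>a\<close>.\<close>

definition dot :: "complex ^ 3 \<Rightarrow> complex ^ 3 \<Rightarrow> complex" where
  "dot a x = (\<Sum>i\<in>UNIV. a $ i * x $ i)"

lemma dot_axis: "dot (axis i 1) x = x $ i"
proof -
  have "dot (axis i 1) x = (\<Sum>k\<in>UNIV. if k = i then x $ k else 0)"
    unfolding dot_def by (intro sum.cong) (auto simp: axis_def)
  then show ?thesis by simp
qed

lemma dot_diff_smult: "dot (a - c *s b) x = dot a x - c * dot b x"
  by (simp add: dot_def sum_subtractf sum_distrib_left algebra_simps)

lemma poly3_eval_lin: "poly3_eval (lin a) x = dot a x"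
proof -
  have "(\<Prod>j\<in>(UNIV :: 3 set). (x $ j) ^ Poly_Mapping.lookup (Poly_Mapping.single i 1) j) = x $ i" for i
  proof -
    have "(\<Prod>j\<in>(UNIV :: 3 set). (x $ j) ^ Poly_Mapping.lookup (Poly_Mapping.single i 1) j)
       = (\<Prod>j\<in>UNIV. if j = i then x $ j else 1)"
      by (intro prod.cong) (auto simp: lookup_single when_def)
    then show ?thesis by simp
  qed
  then show ?thesis
    by (simp add: lin_def dot_def poly3_eval_sum poly3_eval_single)
qed

lemma homogeneous_lin: "homogeneous 1 (lin a)"
  unfolding lin_def by (intro homogeneous_sum homogeneous_single) (simp add: lookup_single when_def)

lemma partial_deriv_sum: "partial_deriv k (sum f A) = (\<Sum>x\<in>A. partial_deriv k (f x))"
  by (induction A rule: infinite_finite_induct) (auto simp: partial_deriv_add)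

lemma partial_deriv_lin: "partial_deriv k (lin a) = Poly_Mapping.single 0 (a $ k)"
proof -
  have "partial_deriv k (lin a) = (\<Sum>i\<in>UNIV. if i = k then Poly_Mapping.single 0 (a $ i) else 0)"
    unfolding lin_def partial_deriv_sum
    by (intro sum.cong) (auto simp: partial_deriv_single lookup_single when_def)
  then show ?thesis by simp
qed

text \<open>Derivatives in all three variables are allowed, so no chart has to be chosen and the
  chart condition \<open>vanishes_to_order\<close> follows. The recursion through first derivatives
  fits the Leibniz rule.\<close>

primrec vanish_ord :: "nat \<Rightarrow> poly3 \<Rightarrow> complex ^ 3 \<Rightarrow> bool" where
  "vanish_ord 0 F v \<longleftrightarrow> True"
| "vanish_ord (Suc m) F v \<longleftrightarrow> poly3_eval F v = 0 \<and> (\<forall>k. vanish_ord m (partial_deriv k F) v)"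

lemma vanish_ord_foldr:
  "vanish_ord m F v \<Longrightarrow> length ks < m \<Longrightarrow> poly3_eval (foldr partial_deriv ks F) v = 0"
\<comment> \<open>\<open>foldr\<close> applies the last entry of the list first, so the list is
  taken apart from its end.\<close>
proof (induction ks arbitrary: m F rule: rev_induct)
  case Nil
  then show ?case by (cases m) auto
next
  case (snoc k ks)
  then show ?case by (cases m) auto
qed

lemma vanish_ord_add: "vanish_ord m F v \<Longrightarrow> vanish_ord m G v \<Longrightarrow> vanish_ord m (F + G) v"
  by (induction m arbitrary: F G) (auto simp: poly3_eval_add partial_deriv_add)

lemma vanish_ord_Suc: "vanish_ord (Suc m) F v \<Longrightarrow> vanish_ord m F v"
  by (induction m arbitrary: F) auto

lemma vanish_ord_mult: "vanish_ord m F v \<Longrightarrow> vanish_ord m (F * G) v"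
proof (induction m arbitrary: F G)
  case (Suc m)
  then show ?case
    using vanish_ord_Suc[OF Suc.prems]
    by (auto simp: poly3_eval_mult partial_deriv_mult intro!: vanish_ord_add)
qed simp

text \<open>In the Leibniz rule, the summand that differentiates \<open>F\<close> loses one order
  and regains it from \<open>G\<close> by induction, while the other summand still contains
  \<open>F\<close> itself.\<close>

lemma vanish_ord_mult_Suc:
  "vanish_ord m F v \<Longrightarrow> poly3_eval G v = 0 \<Longrightarrow> vanish_ord (Suc m) (F * G) v"
proof (induction m arbitrary: F G)
  case (Suc m)
  show ?case
    unfolding vanish_ord.simps(2)[of "Suc m"]
  proof (intro conjI allI)
    fix k
    have "vanish_ord (Suc m) (partial_deriv k F * G) v"
      using Suc by auto
    moreover have "vanish_ord (Suc m) (F * partial_deriv k G) v"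
      using Suc.prems(1) by (rule vanish_ord_mult)
    ultimately show "vanish_ord (Suc m) (partial_deriv k (F * G)) v"
      unfolding partial_deriv_mult by (rule vanish_ord_add)
  qed (use Suc.prems in \<open>simp add: poly3_eval_mult\<close>)
qed (simp add: poly3_eval_mult)

section \<open>Separation of points by a space of functions\<close>

definition lin_closed :: "('a \<Rightarrow> complex) set \<Rightarrow> bool" where
  "lin_closed W \<longleftrightarrow> (\<lambda>_. 0) \<in> W \<and> (\<forall>f\<in>W. \<forall>g\<in>W. \<forall>c. (\<lambda>x. f x + c * g x) \<in> W)"

text \<open>For finite \<open>Z\<close> this says that the evaluations at the points of
  \<open>Z\<close> are linearly independent functionals on \<open>W\<close>, that is, that the
  points impose independent conditions. It is phrased through the dual functions.\<close>

definition separates :: "('a \<Rightarrow> complex) set \<Rightarrow> 'a set \<Rightarrow> bool" where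
  "separates W Z \<longleftrightarrow> (\<forall>p\<in>Z. \<exists>f\<in>W. f p = 1 \<and> (\<forall>p'\<in>Z - {p}. f p' = 0))"

lemma lin_closed_scale:
  assumes "lin_closed W" "f \<in> W"
  shows "(\<lambda>x. c * f x) \<in> W"
  using assms unfolding lin_closed_def by force

lemma lin_closed_add_scale:
  assumes "lin_closed W" "f \<in> W" "g \<in> W"
  shows "(\<lambda>x. f x + c * g x) \<in> W"
  using assms unfolding lin_closed_def by blast

lemma lin_closed_diff_scale:
  assumes "lin_closed W" "f \<in> W" "g \<in> W"
  shows "(\<lambda>x. f x - c * g x) \<in> W"
  using lin_closed_add_scale[OF assms, of "- c"] by simp

lemma lin_closed_sum:
  assumes "lin_closed W" "\<And>p. p \<in> A \<Longrightarrow> f p \<in> W"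
  shows "(\<lambda>x. \<Sum>p\<in>A. c p * f p x) \<in> W"
  using assms(2)
proof (induction A rule: infinite_finite_induct)
  case (insert p A)
  then have "(\<lambda>x. (\<Sum>p\<in>A. c p * f p x) + c p * f p x) \<in> W"
    by (intro lin_closed_add_scale[OF assms(1)]) auto
  with insert show ?case by (simp add: add.commute)
qed (use assms(1) in \<open>auto simp: lin_closed_def\<close>)

lemma separates_subset: "separates W Z \<Longrightarrow> Y \<subseteq> Z \<Longrightarrow> separates W Y"
  unfolding separates_def by blast

lemma separatesI:
  assumes W: "lin_closed W"
    and f: "\<And>p. p \<in> Z \<Longrightarrow> \<exists>f\<in>W. f p \<noteq> 0 \<and> (\<forall>p'\<in>Z - {p}. f p' = 0)"
  shows "separates W Z"
  unfolding separates_def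
proof
  fix p assume "p \<in> Z"
  from f[OF this] obtain g where "g \<in> W" "g p \<noteq> 0" "\<forall>p'\<in>Z - {p}. g p' = 0"
    by blast
  then show "\<exists>f\<in>W. f p = 1 \<and> (\<forall>p'\<in>Z - {p}. f p' = 0)"
    by (intro bexI[of _ "\<lambda>x. (1 / g p) * g x"] lin_closed_scale[OF W]) auto
qed

text \<open>The functions for \<open>A\<close> already vanish on all of \<open>B\<close>, so they
  can correct the values on \<open>A\<close> of a function that separates within \<open>B\<close>.
  Hence the points of \<open>B\<close> only have to be separated among themselves.\<close>

lemma separates_triangular:
  assumes W: "lin_closed W" and "finite A"
    and A: "\<And>p. p \<in> A \<Longrightarrow> \<exists>f\<in>W. f p \<noteq> 0 \<and> (\<forall>p'\<in>A \<union> B - {p}. f p' = 0)"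
    and B: "\<And>p. p \<in> B \<Longrightarrow> \<exists>f\<in>W. f p \<noteq> 0 \<and> (\<forall>p'\<in>B - {p}. f p' = 0)"
    and "A \<inter> B = {}"
  shows "separates W (A \<union> B)"
proof (rule separatesI[OF W])
  fix p assume p: "p \<in> A \<union> B"
  show "\<exists>f\<in>W. f p \<noteq> 0 \<and> (\<forall>p'\<in>A \<union> B - {p}. f p' = 0)"
  proof (cases "p \<in> A")
    case False
    with p B obtain g where g: "g \<in> W" "g p \<noteq> 0" "\<forall>p'\<in>B - {p}. g p' = 0"
      by blast
    obtain f where f: "\<And>p. p \<in> A \<Longrightarrow> f p \<in> W \<and> f p p \<noteq> 0 \<and> (\<forall>p'\<in>A \<union> B - {p}. f p p' = 0)"
      using A by metis
    \<comment> \<open>The subtracted sum interpolates \<open>g\<close> on \<open>A\<close> and is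
      zero on \<open>B\<close>.\<close>
    define h where "h = (\<lambda>x. g x + (- 1) * (\<Sum>a\<in>A. (g a / f a a) * f a x))"
    have "h \<in> W"
      unfolding h_def using f g(1)
      by (intro lin_closed_add_scale lin_closed_sum W) auto
    moreover have "h b = g b" if "b \<in> B" for b
    proof -
      have "(\<Sum>a\<in>A. (g a / f a a) * f a b) = 0"
        using that f \<open>A \<inter> B = {}\<close> by (intro sum.neutral) auto
      then show ?thesis by (simp add: h_def)
    qed
    moreover have "h a = 0" if "a \<in> A" for a
    proof -
      have "(\<Sum>a'\<in>A. (g a' / f a' a') * f a' a) = (\<Sum>a'\<in>A. if a' = a then g a else 0)"
        using that f by (intro sum.cong) auto
      with that \<open>finite A\<close> show ?thesis by (simp add: h_def)
    qed
    ultimately show ?thesis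
      using g p False by (intro bexI[of _ h]) auto
  qed (use A in blast)
qed

text \<open>When a point \<open>z\<close> is added to a separated set, either some function in
  \<open>W\<close> vanishes on the set but not at \<open>z\<close>, and separation extends, or the
  value at \<open>z\<close> is determined by the values on the set, which is a linear
  relation.\<close>

lemma separates_or_annihilator:
  assumes W: "lin_closed W" and "finite Z"
  shows "separates W Z \<or> (\<exists>c. (\<exists>p\<in>Z. c p \<noteq> 0) \<and> (\<forall>f\<in>W. (\<Sum>p\<in>Z. c p * f p) = 0))"
  using \<open>finite Z\<close>
proof (induction Z)
  case empty
  show ?case by (simp add: separates_def)
next
  case (insert z Z)
  show ?case
  proof (cases "separates W Z")
    case False
    with insert.IH obtain c p where c: "p \<in> Z" "c p \<noteq> 0" "\<forall>f\<in>W. (\<Sum>p\<in>Z. c p * f p) = 0"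
      by blast
    have "(\<Sum>p\<in>insert z Z. (c(z := 0)) p * f p) = (\<Sum>p\<in>Z. c p * f p)" for f
      using insert.hyps by (auto intro!: sum.cong)
    with c insert.hyps show ?thesis
      by (intro disjI2 exI[of _ "c(z := 0)"] conjI bexI[of _ p]) auto
  next
    case True
    then obtain F where F: "\<And>p. p \<in> Z \<Longrightarrow> F p \<in> W \<and> F p p = 1 \<and> (\<forall>p'\<in>Z - {p}. F p p' = 0)"
      unfolding separates_def by metis
    show ?thesis
    proof (cases "\<exists>g\<in>W. (\<forall>p\<in>Z. g p = 0) \<and> g z \<noteq> 0")
      case True
      then obtain g where g: "g \<in> W" "\<forall>p\<in>Z. g p = 0" "g z \<noteq> 0" by blast
      have "separates W (Z \<union> {z})"
      proof (rule separatesI[OF W])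
        fix p assume "p \<in> Z \<union> {z}"
        show "\<exists>f\<in>W. f p \<noteq> 0 \<and> (\<forall>p'\<in>Z \<union> {z} - {p}. f p' = 0)"
        proof (cases "p = z")
          case False
          with \<open>p \<in> Z \<union> {z}\<close> have "p \<in> Z" by simp
          then show ?thesis
            using F[of p] g False
            by (intro bexI[of _ "\<lambda>x. F p x - (F p z / g z) * g x"] lin_closed_diff_scale[OF W]) auto
        qed (use g in auto)
      qed
      then show ?thesis by simp
    next
      case False
      \<comment> \<open>The relation says that \<open>f z\<close> is the value at \<open>z\<close>
        of the interpolation of \<open>f\<close> on \<open>Z\<close> by the dual functions
        \<open>F p\<close>.\<close>
      define c where "c = (\<lambda>p. if p = z then 1 else - F p z)"
      have "(\<Sum>p\<in>insert z Z. c p * f p) = 0" if "f \<in> W" for f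
      proof -
        define g where "g = (\<lambda>x. f x - 1 * (\<Sum>p\<in>Z. f p * F p x))"
        have "g \<in> W"
          unfolding g_def using F that by (intro lin_closed_diff_scale lin_closed_sum W) auto
        moreover have "g a = 0" if "a \<in> Z" for a
        proof -
          have "(\<Sum>p\<in>Z. f p * F p a) = (\<Sum>p\<in>Z. if p = a then f a else 0)"
            using that F by (intro sum.cong) auto
          with that insert.hyps show ?thesis by (simp add: g_def)
        qed
        ultimately have "g z = 0" using False by blast
        moreover have "(\<Sum>p\<in>Z. c p * f p) = - (\<Sum>p\<in>Z. f p * F p z)"
          using insert.hyps unfolding sum_negf[symmetric] by (intro sum.cong) (auto simp: c_def)
        ultimately show ?thesis
          using insert.hyps by (simp add: g_def) (simp add: c_def)
      qed
      moreover have "c z \<noteq> 0" by (simp add: c_def)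
      ultimately show ?thesis by blast
    qed
  qed
qed

text \<open>The matrix of values is so close to the identity that it is strictly diagonally
  dominant, hence invertible. This is what makes separation an open condition.\<close>

lemma diag_dominant_separates:
  assumes W: "lin_closed W" and "finite Z"
    and F: "\<And>p. p \<in> Z \<Longrightarrow> F p \<in> W"
    and dom: "\<And>p p'. p \<in> Z \<Longrightarrow> p' \<in> Z \<Longrightarrow>
      norm (F p p' - (if p = p' then 1 else 0)) < 1 / real (card Z + 1)"
  shows "separates W Z"
proof (rule ccontr)
  assume "\<not> separates W Z"
  with separates_or_annihilator[OF W \<open>finite Z\<close>]
  obtain c where c: "\<exists>p\<in>Z. c p \<noteq> 0" "\<And>f. f \<in> W \<Longrightarrow> (\<Sum>p\<in>Z. c p * f p) = 0"
    by blast
  have "Z \<noteq> {}" using c by auto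
  define M where "M = Max ((\<lambda>p. norm (c p)) ` Z)"
  have "M \<in> (\<lambda>p. norm (c p)) ` Z"
    unfolding M_def using \<open>finite Z\<close> \<open>Z \<noteq> {}\<close> by (intro Max_in) auto
  then obtain p where p: "p \<in> Z" "norm (c p) = M" by auto
  have le: "norm (c p') \<le> M" if "p' \<in> Z" for p'
    unfolding M_def using \<open>finite Z\<close> that by (intro Max_ge) auto
  have "M > 0"
  proof -
    obtain p' where "p' \<in> Z" "c p' \<noteq> 0" using c(1) by blast
    with le[of p'] show ?thesis by (smt (verit) zero_less_norm_iff)
  qed
  \<comment> \<open>The relation is applied to the function \<open>F p\<close> that belongs to a
    coefficient of maximal norm.\<close>
  have "c p = (\<Sum>p'\<in>Z. c p' * (if p = p' then 1 else 0))"
    using p \<open>finite Z\<close> by (simp add: if_distrib cong: if_cong)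
  also have "\<dots> = - (\<Sum>p'\<in>Z. c p' * (F p p' - (if p = p' then 1 else 0)))"
    using c(2)[OF F[OF p(1)]] by (simp add: algebra_simps sum_subtractf)
  finally have "M = norm (\<Sum>p'\<in>Z. c p' * (F p p' - (if p = p' then 1 else 0)))"
    using p by (metis norm_minus_cancel)
  also have "\<dots> \<le> (\<Sum>p'\<in>Z. M * (1 / real (card Z + 1)))"
  proof (rule sum_norm_le)
    fix p' assume "p' \<in> Z"
    then show "norm (c p' * (F p p' - (if p = p' then 1 else 0))) \<le> M * (1 / real (card Z + 1))"
      unfolding norm_mult using dom[OF p(1), of p'] le[of p'] \<open>M > 0\<close>
      by (intro mult_mono) auto
  qed
  also have "\<dots> = M * (real (card Z) / real (card Z + 1))" by simp
  also have "\<dots> < M * 1"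
    using \<open>M > 0\<close> by (intro mult_strict_left_mono) auto
  finally show False by simp
qed

text \<open>A greedy choice of a basis among the evaluations: a point is added exactly when some
  function vanishes on the points chosen so far but not there.\<close>

lemma maximal_separated_subset:
  assumes W: "lin_closed W" and "finite Z"
  shows "\<exists>Y\<subseteq>Z. separates W Y \<and> (\<forall>f\<in>W. (\<forall>p\<in>Y. f p = 0) \<longrightarrow> (\<forall>p\<in>Z. f p = 0))"
  using \<open>finite Z\<close>
proof (induction Z)
  case empty
  show ?case by (simp add: separates_def)
next
  case (insert z Z)
  then obtain Y where Y: "Y \<subseteq> Z" "separates W Y" "\<forall>f\<in>W. (\<forall>p\<in>Y. f p = 0) \<longrightarrow> (\<forall>p\<in>Z. f p = 0)"
    by blast
  show ?case
  proof (cases "\<forall>f\<in>W. (\<forall>p\<in>Y. f p = 0) \<longrightarrow> f z = 0")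
    case False
    then obtain g where g: "g \<in> W" "\<forall>p\<in>Y. g p = 0" "g z \<noteq> 0" by blast
    have "separates W (insert z Y)"
    proof -
      have "separates W ({z} \<union> Y)"
      proof (rule separates_triangular[OF W])
        fix p assume "p \<in> Y"
        with Y(2) show "\<exists>f\<in>W. f p \<noteq> 0 \<and> (\<forall>p'\<in>Y - {p}. f p' = 0)"
          unfolding separates_def by (metis zero_neq_one)
      next
        fix p assume "p \<in> {z}"
        with g show "\<exists>f\<in>W. f p \<noteq> 0 \<and> (\<forall>p'\<in>{z} \<union> Y - {p}. f p' = 0)"
          by (intro bexI[of _ g]) auto
      qed (use Y(1) insert.hyps(2) in auto)
      then show ?thesis by simp
    qed
    with Y show ?thesis by (intro exI[of _ "insert z Y"]) auto
  qed (use Y in blast)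
qed

text \<open>Every condition \<open>f z = 0\<close> costs at most one point of a separated set.\<close>

lemma exists_vanishing_nonzero:
  assumes "finite Z" "lin_closed W" "separates W T" "card Z < card T"
  shows "\<exists>f\<in>W. (\<forall>p\<in>Z. f p = 0) \<and> (\<exists>t\<in>T. f t \<noteq> 0)"
  using assms
proof (induction Z arbitrary: W T)
  case empty
  then obtain t where "t \<in> T" by fastforce
  with empty(2) obtain f where "f \<in> W" "f t = 1" unfolding separates_def by blast
  with \<open>t \<in> T\<close> show ?case by (intro bexI[of _ f]) (auto intro: bexI[of _ t])
next
  case (insert z Z)
  have "finite T" using insert.prems(3) by (metis card.infinite not_less_zero)
  define W1 where "W1 = {f \<in> W. f z = 0}"
  have W1: "lin_closed W1" using insert.prems(1) unfolding lin_closed_def W1_def by auto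
  obtain F where F: "\<And>p. p \<in> T \<Longrightarrow> F p \<in> W \<and> F p p = 1 \<and> (\<forall>p'\<in>T - {p}. F p p' = 0)"
    using insert.prems(2) unfolding separates_def by metis
  have "\<exists>T'\<subseteq>T. card Z < card T' \<and> separates W1 T'"
  proof (cases "\<forall>t\<in>T. F t z = 0")
    case True
    then have "separates W1 T"
      unfolding separates_def W1_def using F by blast
    with insert show ?thesis by (intro exI[of _ T]) auto
  next
    case False
    then obtain s where s: "s \<in> T" "F s z \<noteq> 0" by blast
    \<comment> \<open>One elimination step: multiples of \<open>F s\<close> make all other dual
      functions vanish at \<open>z\<close>, at the cost of the point \<open>s\<close>.\<close>
    have "separates W1 (T - {s})"
      unfolding separates_def
    proof
      fix t assume t: "t \<in> T - {s}"
      have "(\<lambda>x. F t x - (F t z / F s z) * F s x) \<in> W"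
        using F t s by (intro lin_closed_diff_scale insert.prems(1)) auto
      then show "\<exists>f\<in>W1. f t = 1 \<and> (\<forall>p'\<in>T - {s} - {t}. f p' = 0)"
        using F[of t] F[of s] s t unfolding W1_def
        by (intro bexI[of _ "\<lambda>x. F t x - (F t z / F s z) * F s x"]) auto
    qed
    moreover have "card Z < card (T - {s})"
      using insert.prems(3) insert.hyps s \<open>finite T\<close> by simp
    ultimately show ?thesis by blast
  qed
  then obtain T' where "T' \<subseteq> T" "card Z < card T'" "separates W1 T'" by blast
  with insert.IH[OF W1] obtain f where "f \<in> W1" "\<forall>p\<in>Z. f p = 0" "\<exists>t\<in>T'. f t \<noteq> 0" by blast
  with \<open>T' \<subseteq> T\<close> show ?case by (auto simp: W1_def)
qed

section \<open>Points and lines\<close>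

text \<open>The bilinear cross product. It is zero exactly when the vectors are linearly dependent;
  otherwise it is the coefficient vector of the line through the two points.\<close>

definition cr :: "complex ^ 3 \<Rightarrow> complex ^ 3 \<Rightarrow> complex ^ 3" where
  "cr u v = vector [u$2 * v$3 - u$3 * v$2, u$3 * v$1 - u$1 * v$3, u$1 * v$2 - u$2 * v$1]"

text \<open>The determinant: for fixed \<open>u\<close> and \<open>v\<close> it is the equation of
  their line, and it vanishes exactly on collinear triples.\<close>

definition det3 :: "complex ^ 3 \<Rightarrow> complex ^ 3 \<Rightarrow> complex ^ 3 \<Rightarrow> complex" where
  "det3 u v w = dot (cr u v) w"

lemmas det3_expand = det3_def cr_def dot_def sum_3 vector_3 vector_add_component
  vector_smult_component

lemma det3_rotate: "det3 u v w = det3 v w u"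
  by (simp add: det3_expand algebra_simps)

lemma det3_same [simp]: "det3 u u w = 0" "det3 u w u = 0" "det3 w u u = 0"
  by (simp_all add: det3_expand algebra_simps)

lemma det3_add_smult: "det3 u v (a *s x + b *s y) = a * det3 u v x + b * det3 u v y"
  by (simp add: det3_expand algebra_simps)

lemma cr_eq_0_commute: "cr u v = 0 \<longleftrightarrow> cr v u = 0"
  by (simp add: vec_eq_iff forall_3 cr_def vector_3) (auto simp: algebra_simps)

lemma cr_eq_0_iff:
  assumes "u \<noteq> 0"
  shows "cr u v = 0 \<longleftrightarrow> (\<exists>c. v = c *s u)"
proof
  assume *: "cr u v = 0"
  from assms obtain i where i: "u $ i \<noteq> 0" by (auto simp: vec_eq_iff)
  have "u $ i * v $ k = v $ i * u $ k" for k
    using * exhaust_3[of i] exhaust_3[of k] by (auto simp: vec_eq_iff forall_3 cr_def vector_3 algebra_simps)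
  with i have "v = (v $ i / u $ i) *s u"
    by (simp add: vec_eq_iff field_simps)
  then show "\<exists>c. v = c *s u" by blast
qed (auto simp: vec_eq_iff forall_3 cr_def vector_3 algebra_simps)

lemma cr_nonzero_imp: "cr u v \<noteq> 0 \<Longrightarrow> u \<noteq> 0" "cr u v \<noteq> 0 \<Longrightarrow> v \<noteq> 0"
  by (auto simp: vec_eq_iff forall_3 cr_def vector_3)

lemma cr_nonzero_iff_det3: "cr u v \<noteq> 0 \<longleftrightarrow> (\<exists>w. det3 u v w \<noteq> 0)"
proof
  assume "cr u v \<noteq> 0"
  then obtain i where "cr u v $ i \<noteq> 0" by (auto simp: vec_eq_iff)
  then have "det3 u v (axis i 1) \<noteq> 0"
    by (simp add: det3_def dot_def axis_def if_distrib cong: if_cong)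
  then show "\<exists>w. det3 u v w \<noteq> 0" by blast
qed (auto simp: det3_def dot_def)

lemma cramer3: "det3 u v w *s x = det3 x v w *s u + det3 u x w *s v + det3 u v x *s w"
  by (simp add: vec_eq_iff forall_3 det3_expand) (simp add: algebra_simps)

text \<open>With an auxiliary \<open>w\<close> off the line, the coefficient of \<open>w\<close> in
  Cramer's formula for \<open>x\<close> is \<open>det3 u v x\<close>, which is zero.\<close>

lemma det3_zero_imp_span:
  assumes "cr u v \<noteq> 0" "det3 u v x = 0"
  shows "\<exists>a b. x = a *s u + b *s v"
proof -
  obtain w where w: "det3 u v w \<noteq> 0" using assms(1) cr_nonzero_iff_det3 by blast
  have "x = (1 / det3 u v w) *s (det3 u v w *s x)" using w by simp
  also have "\<dots> = (det3 x v w / det3 u v w) *s u + (det3 u x w / det3 u v w) *s v"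
    unfolding cramer3[of u v w x] using assms(2) by (simp add: vec.scale_right_distrib)
  finally show ?thesis by blast
qed

lemma det3_trans:
  assumes "cr u v \<noteq> 0" "det3 u v x = 0" "det3 u v y = 0"
  shows "det3 u x y = 0" "det3 v x y = 0"
proof -
  obtain a b c d where "x = a *s u + b *s v" "y = c *s u + d *s v"
    using det3_zero_imp_span assms by metis
  then show "det3 u x y = 0" "det3 v x y = 0"
    by (simp_all add: det3_expand algebra_simps)
qed

text \<open>On the curve \<open>(1, t, t^2)\<close> each plane becomes a nonzero polynomial in
  \<open>t\<close>, so finitely many planes exclude only finitely many parameters.\<close>

lemma exists_avoiding_planes:
  assumes "finite A" "\<And>a. a \<in> A \<Longrightarrow> a \<noteq> 0"
  shows "\<exists>q. \<forall>a\<in>A. dot a q \<noteq> 0"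
proof -
  define P where "P = (\<lambda>a :: complex ^ 3. [:a$1, a$2, a$3:])"
  have "finite (\<Union>a\<in>A. {t. poly (P a) t = 0})"
    using assms by (intro finite_UN_I poly_roots_finite) (auto simp: P_def vec_eq_iff forall_3)
  then obtain t where t: "t \<notin> (\<Union>a\<in>A. {t. poly (P a) t = 0})"
    using ex_new_if_finite infinite_UNIV_char_0 by blast
  have "dot a (vector [1, t, t ^ 2]) = poly (P a) t" for a
    by (simp add: dot_def sum_3 P_def vector_3 power2_eq_square algebra_simps)
  with t show ?thesis by (intro exI[of _ "vector [1, t, t ^ 2]"]) auto
qed

section \<open>Forms with a multiple point\<close>

definition form :: "nat \<Rightarrow> (complex ^ 3 \<Rightarrow> complex) set" where
  "form d = {poly3_eval F | F. homogeneous d F}"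

text \<open>All multiples of \<open>q\<close> are included because multiplicity is finally tested at
  the representative with a coordinate equal to 1, whereas \<open>q\<close> is an arbitrary
  vector.\<close>

definition mform :: "nat \<Rightarrow> nat \<Rightarrow> complex ^ 3 \<Rightarrow> (complex ^ 3 \<Rightarrow> complex) set" where
  "mform d m q = {poly3_eval F | F. homogeneous d F \<and> (\<forall>c. vanish_ord m F (c *s q))}"

text \<open>\<open>ext_mform\<close> consists of the forms with an \<open>m\<close>-fold point at \<open>q\<^sub>0\<close> that deform continuously along with the point.
  They make separation at one special \<open>q\<^sub>0\<close> spread to all nearby points.\<close>

definition ext_mform :: "nat \<Rightarrow> nat \<Rightarrow> complex ^ 3 \<Rightarrow> (complex ^ 3 \<Rightarrow> complex) set" where
  "ext_mform d m q\<^sub>0 =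
     {\<Phi> q\<^sub>0 | \<Phi>. (\<forall>q. \<Phi> q \<in> mform d m q) \<and> (\<forall>x. isCont (\<lambda>q. \<Phi> q x) q\<^sub>0)}"

lemma lin_closed_form: "lin_closed (form d)"
  unfolding lin_closed_def form_def
proof (intro conjI ballI allI)
  show "(\<lambda>_. 0) \<in> {poly3_eval F |F. homogeneous d F}"
    by (auto intro!: exI[of _ 0])
next
  fix f g :: "complex ^ 3 \<Rightarrow> complex" and c :: complex
  assume "f \<in> {poly3_eval F |F. homogeneous d F}" "g \<in> {poly3_eval F |F. homogeneous d F}"
  then obtain F G where "f = poly3_eval F" "homogeneous d F" "g = poly3_eval G" "homogeneous d G"
    by blast
  then show "(\<lambda>x. f x + c * g x) \<in> {poly3_eval F |F. homogeneous d F}"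
    by (auto intro!: exI[of _ "F + poly3_scale c G"] homogeneous_add homogeneous_scale
        simp: poly3_eval_add poly3_eval_scale fun_eq_iff)
qed

lemma vanish_ord_zero [simp]: "vanish_ord m 0 v"
  by (induction m) auto

lemma vanish_ord_scale: "vanish_ord m F v \<Longrightarrow> vanish_ord m (poly3_scale c F) v"
  using vanish_ord_mult[of m F v "Poly_Mapping.single 0 c"]
  by (simp add: poly3_scale_def mult.commute)

lemma lin_closed_mform: "lin_closed (mform d m q)"
  unfolding lin_closed_def mform_def
proof (intro conjI ballI allI)
  show "(\<lambda>_. 0) \<in> {poly3_eval F |F. homogeneous d F \<and> (\<forall>c. vanish_ord m F (c *s q))}"
    by (auto intro!: exI[of _ 0])
next
  fix f g :: "complex ^ 3 \<Rightarrow> complex" and c :: complex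
  assume "f \<in> {poly3_eval F |F. homogeneous d F \<and> (\<forall>c. vanish_ord m F (c *s q))}"
    "g \<in> {poly3_eval F |F. homogeneous d F \<and> (\<forall>c. vanish_ord m F (c *s q))}"
  then obtain F G where "f = poly3_eval F" "homogeneous d F" "g = poly3_eval G" "homogeneous d G"
    "\<forall>c. vanish_ord m F (c *s q)" "\<forall>c. vanish_ord m G (c *s q)"
    by blast
  then show "(\<lambda>x. f x + c * g x) \<in> {poly3_eval F |F. homogeneous d F \<and> (\<forall>c. vanish_ord m F (c *s q))}"
    by (auto intro!: exI[of _ "F + poly3_scale c G"] homogeneous_add homogeneous_scale
        vanish_ord_add vanish_ord_scale simp: poly3_eval_add poly3_eval_scale fun_eq_iff)
qed

lemma lin_closed_ext_mform: "lin_closed (ext_mform d m q)"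
  unfolding lin_closed_def ext_mform_def
proof (intro conjI ballI allI)
  show "(\<lambda>_. 0) \<in> {\<Phi> q |\<Phi>. (\<forall>q. \<Phi> q \<in> mform d m q) \<and> (\<forall>x. isCont (\<lambda>q. \<Phi> q x) q)}"
    using lin_closed_mform[of d m] by (auto simp: lin_closed_def intro!: exI[of _ "\<lambda>_ _. 0"])
next
  fix f g :: "complex ^ 3 \<Rightarrow> complex" and c :: complex
  assume "f \<in> {\<Phi> q |\<Phi>. (\<forall>q. \<Phi> q \<in> mform d m q) \<and> (\<forall>x. isCont (\<lambda>q. \<Phi> q x) q)}"
    "g \<in> {\<Phi> q |\<Phi>. (\<forall>q. \<Phi> q \<in> mform d m q) \<and> (\<forall>x. isCont (\<lambda>q. \<Phi> q x) q)}"
  then obtain \<Phi> \<Psi> where "f = \<Phi> q" "g = \<Psi> q" "\<And>q. \<Phi> q \<in> mform d m q" "\<And>q. \<Psi> q \<in> mform d m q"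
    "\<And>x. isCont (\<lambda>q. \<Phi> q x) q" "\<And>x. isCont (\<lambda>q. \<Psi> q x) q"
    by blast
  then show "(\<lambda>x. f x + c * g x) \<in> {\<Phi> q |\<Phi>. (\<forall>q. \<Phi> q \<in> mform d m q) \<and> (\<forall>x. isCont (\<lambda>q. \<Phi> q x) q)}"
    by (auto intro!: exI[of _ "\<lambda>q x. \<Phi> q x + c * \<Psi> q x"] lin_closed_add_scale[OF lin_closed_mform]
        continuous_intros)
qed

section \<open>Products of forms and their multiplicities\<close>

lemma isCont_poly3_eval: "isCont (poly3_eval F) q"
  unfolding poly3_eval_def by (intro continuous_intros)

lemma form_smult: "f \<in> form d \<Longrightarrow> f (c *s x) = c ^ d * f x"
  by (auto simp: form_def poly3_eval_smult)

lemma form_mult: "f \<in> form d \<Longrightarrow> g \<in> form e \<Longrightarrow> (\<lambda>x. f x * g x) \<in> form (d + e)"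
  unfolding form_def by (force intro: homogeneous_mult simp: poly3_eval_mult[symmetric])

lemma dot_form: "dot a \<in> form 1"
  unfolding form_def using homogeneous_lin poly3_eval_lin by (auto intro!: exI[of _ "lin a"])

lemma det3_form: "det3 u v \<in> form 1"
  using dot_form[of "cr u v"] by (simp add: det3_def[abs_def])

lemma mform_mult:
  assumes "f \<in> mform d 1 q" "g \<in> mform e m q"
  shows "(\<lambda>x. f x * g x) \<in> mform (d + e) (Suc m) q"
proof -
  from assms obtain F G where F: "f = poly3_eval F" "homogeneous d F" "\<forall>c. vanish_ord 1 F (c *s q)"
    and G: "g = poly3_eval G" "homogeneous e G" "\<forall>c. vanish_ord m G (c *s q)"
    unfolding mform_def by blast
  have "\<forall>c. vanish_ord (Suc m) (F * G) (c *s q)"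
    using vanish_ord_mult_Suc[of m G _ F] F G by (simp add: mult.commute)
  then show ?thesis
    using F G unfolding mform_def
    by (auto intro!: exI[of _ "F * G"] homogeneous_mult simp: poly3_eval_mult fun_eq_iff)
qed

lemma mform_form_mult:
  assumes "f \<in> form d" "g \<in> mform e m q"
  shows "(\<lambda>x. f x * g x) \<in> mform (d + e) m q"
proof -
  from assms obtain F G where F: "f = poly3_eval F" "homogeneous d F"
    and G: "g = poly3_eval G" "homogeneous e G" "\<forall>c. vanish_ord m G (c *s q)"
    unfolding mform_def form_def by blast
  have "\<forall>c. vanish_ord m (F * G) (c *s q)"
    using vanish_ord_mult[of m G _ F] F G by (simp add: mult.commute)
  then show ?thesis
    using F G unfolding mform_def
    by (auto intro!: exI[of _ "F * G"] homogeneous_mult simp: poly3_eval_mult fun_eq_iff)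
qed

lemma form_mform_1: "f \<in> form d \<Longrightarrow> f q = 0 \<Longrightarrow> 0 < d \<Longrightarrow> f \<in> mform d 1 q"
  unfolding form_def mform_def by (auto simp: poly3_eval_smult)

lemma one_ext_mform: "(\<lambda>_. 1) \<in> ext_mform 0 0 q"
  unfolding ext_mform_def mform_def
  by (auto intro!: exI[of _ "\<lambda>_ _. 1"] exI[of _ 1] homogeneous_one)

lemma ext_mform_mult:
  assumes "f \<in> ext_mform d 1 q" "g \<in> ext_mform e m q"
  shows "(\<lambda>x. f x * g x) \<in> ext_mform (d + e) (Suc m) q"
proof -
  from assms obtain \<Phi> \<Psi> where "f = \<Phi> q" "g = \<Psi> q" "\<And>q. \<Phi> q \<in> mform d 1 q" "\<And>q. \<Psi> q \<in> mform e m q"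
    "\<And>x. isCont (\<lambda>q. \<Phi> q x) q" "\<And>x. isCont (\<lambda>q. \<Psi> q x) q"
    unfolding ext_mform_def by blast
  then show ?thesis unfolding ext_mform_def
    by (auto intro!: exI[of _ "\<lambda>q x. \<Phi> q x * \<Psi> q x"] mform_mult continuous_intros)
qed

lemma ext_mform_form_mult:
  assumes "f \<in> form d" "g \<in> ext_mform e m q"
  shows "(\<lambda>x. f x * g x) \<in> ext_mform (d + e) m q"
proof -
  from assms obtain \<Psi> where "g = \<Psi> q" "\<And>q. \<Psi> q \<in> mform e m q" "\<And>x. isCont (\<lambda>q. \<Psi> q x) q"
    unfolding ext_mform_def by blast
  with assms(1) show ?thesis unfolding ext_mform_def
    by (auto intro!: exI[of _ "\<lambda>q x. f x * \<Psi> q x"] mform_form_mult continuous_intros)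
qed

text \<open>The line joining \<open>u\<close> to \<open>q\<close> moves continuously with
  \<open>q\<close>.\<close>

lemma det3_ext_mform: "det3 u q \<in> ext_mform 1 1 q"
  unfolding ext_mform_def
proof (intro CollectI exI conjI allI)
  show "isCont (\<lambda>q. det3 u q x) q" for x
    unfolding det3_expand by (intro continuous_intros)
  show "det3 u q \<in> mform 1 1 q" for q
    by (rule form_mform_1[OF det3_form]) simp_all
qed simp

text \<open>This is the member through \<open>q\<close> of the pencil spanned by \<open>f\<close>
  and \<open>g\<close>; its coefficients depend continuously on \<open>q\<close>.\<close>

lemma pencil_ext_mform:
  assumes "f \<in> form d" "g \<in> form d" "0 < d"
  shows "(\<lambda>x. g q * f x - f q * g x) \<in> ext_mform d 1 q"
  unfolding ext_mform_def
proof (intro CollectI exI[of _ "\<lambda>q x. g q * f x - f q * g x"] conjI allI)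
  have "isCont f q" "isCont g q" using assms isCont_poly3_eval by (auto simp: form_def)
  then show "isCont (\<lambda>q. g q * f x - f q * g x) q" for x by (intro continuous_intros)
next
  fix q
  show "(\<lambda>x. g q * f x - f q * g x) \<in> mform d 1 q"
    using assms
    by (intro form_mform_1 lin_closed_diff_scale[OF lin_closed_form]
        lin_closed_scale[OF lin_closed_form]) auto
qed simp

text \<open>The matrix of values of the deformed dual forms is the identity at
  \<open>q\<^sub>0\<close> and varies continuously, so nearby it stays diagonally dominant.\<close>

lemma ext_mform_separates_near:
  assumes "separates (ext_mform d m q\<^sub>0) Z" "finite Z"
  shows "\<forall>\<^sub>F q in nhds q\<^sub>0. separates (mform d m q) Z"
proof -
  have "\<exists>\<Phi>. \<forall>p\<in>Z. (\<forall>q. \<Phi> p q \<in> mform d m q) \<and> (\<forall>x. isCont (\<lambda>q. \<Phi> p q x) q\<^sub>0) \<and>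
      \<Phi> p q\<^sub>0 p = 1 \<and> (\<forall>p'\<in>Z - {p}. \<Phi> p q\<^sub>0 p' = 0)"
  proof (intro bchoice ballI)
    fix p assume "p \<in> Z"
    with assms(1) show "\<exists>\<Phi>. (\<forall>q. \<Phi> q \<in> mform d m q) \<and> (\<forall>x. isCont (\<lambda>q. \<Phi> q x) q\<^sub>0) \<and>
      \<Phi> q\<^sub>0 p = 1 \<and> (\<forall>p'\<in>Z - {p}. \<Phi> q\<^sub>0 p' = 0)"
      unfolding separates_def ext_mform_def by blast
  qed
  then obtain \<Phi> where \<Phi>: "\<And>p q. p \<in> Z \<Longrightarrow> \<Phi> p q \<in> mform d m q"
    "\<And>p x. p \<in> Z \<Longrightarrow> isCont (\<lambda>q. \<Phi> p q x) q\<^sub>0"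
    "\<And>p p'. p \<in> Z \<Longrightarrow> p' \<in> Z \<Longrightarrow> \<Phi> p q\<^sub>0 p' = (if p = p' then 1 else 0)"
    by (metis Diff_iff singletonD)
  let ?\<epsilon> = "1 / real (card Z + 1)"
  have "\<forall>\<^sub>F q in nhds q\<^sub>0. \<forall>p\<in>Z. \<forall>p'\<in>Z. norm (\<Phi> p q p' - (if p = p' then 1 else 0)) < ?\<epsilon>"
  proof (intro eventually_ball_finite ballI assms(2))
    fix p p' assume p: "p \<in> Z" "p' \<in> Z"
    have "((\<lambda>q. \<Phi> p q p') \<longlongrightarrow> \<Phi> p q\<^sub>0 p') (at q\<^sub>0)"
      using \<Phi>(2)[OF p(1), of p'] by (simp add: isCont_def)
    then have "((\<lambda>q. \<Phi> p q p') \<longlongrightarrow> \<Phi> p q\<^sub>0 p') (nhds q\<^sub>0)"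
      using tendsto_at_iff_tendsto_nhds[of "\<lambda>q. \<Phi> p q p'"] by blast
    from tendstoD[OF this, of ?\<epsilon>] show "\<forall>\<^sub>F q in nhds q\<^sub>0. norm (\<Phi> p q p' - (if p = p' then 1 else 0)) < ?\<epsilon>"
      unfolding \<Phi>(3)[OF p] by (simp add: dist_norm)
  qed
  then show ?thesis
  proof eventually_elim
    case (elim q)
    then show ?case
      using \<Phi>(1) by (intro diag_dominant_separates[of _ _ "\<lambda>p. \<Phi> p q"] lin_closed_mform assms(2)) auto
  qed
qed

text \<open>On the line from \<open>q\<^sub>0\<close> to \<open>q\<^sub>1\<close> the form
  \<open>g\<close> has finitely many zeros, so points of this line close to \<open>q\<^sub>0\<close>
  avoid them and inherit separation. Here \<open>g\<close> stands for an equation bounding the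
  generic locus.\<close>

lemma separates_at_nonzero:
  assumes "separates (ext_mform d m q\<^sub>0) Z" "finite Z" "q\<^sub>0 \<noteq> 0"
    and G: "g \<in> form e" "g q\<^sub>1 \<noteq> 0"
  shows "\<exists>q. q \<noteq> 0 \<and> g q \<noteq> 0 \<and> separates (mform d m q) Z"
proof -
  obtain P where P: "\<And>t. g (q\<^sub>0 + t *s (q\<^sub>1 - q\<^sub>0)) = poly P t"
    using G(1) poly3_eval_on_line unfolding form_def by blast
  \<comment> \<open>The parameter 1 gives the point \<open>q\<^sub>1\<close>, where \<open>g\<close>
    is nonzero.\<close>
  have "P \<noteq> 0" using G(2) P[of 1] by auto
  let ?S = "{t. poly P t = 0}"
  have "finite ?S" using \<open>P \<noteq> 0\<close> by (rule poly_roots_finite)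
  then have "\<forall>\<^sub>F t in nhds 0. t \<in> - (?S - {0})"
    by (intro eventually_nhds_in_open open_Compl finite_imp_closed) auto
  then have ev1: "\<forall>\<^sub>F t in at 0. poly P t \<noteq> 0"
    unfolding eventually_at_filter by eventually_elim auto
  have lim: "((\<lambda>t. q\<^sub>0 + t *s (q\<^sub>1 - q\<^sub>0)) \<longlongrightarrow> q\<^sub>0) (at 0)"
    by (rule vec_tendstoI) (auto intro!: tendsto_eq_intros)
  have "\<forall>\<^sub>F q in nhds q\<^sub>0. separates (mform d m q) Z \<and> q \<noteq> 0"
    using ext_mform_separates_near[OF assms(1,2)] assms(3)
    by (intro eventually_conj t1_space_nhds) auto
  from filterlim_iff[THEN iffD1, OF lim, rule_format, OF this] ev1
  have "\<forall>\<^sub>F t in at (0 :: complex). separates (mform d m (q\<^sub>0 + t *s (q\<^sub>1 - q\<^sub>0))) Z \<and>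
      q\<^sub>0 + t *s (q\<^sub>1 - q\<^sub>0) \<noteq> 0 \<and> g (q\<^sub>0 + t *s (q\<^sub>1 - q\<^sub>0)) \<noteq> 0"
    by eventually_elim (metis P)
  then show ?thesis
    using eventually_happens'[OF trivial_limit_at] by blast
qed

section \<open>Points with many collinear ones\<close>

text \<open>The vectors represent pairwise different points of the projective plane.\<close>

definition distinct_points :: "(complex ^ 3) set \<Rightarrow> bool" where
  "distinct_points Z \<longleftrightarrow> 0 \<notin> Z \<and> (\<forall>p\<in>Z. \<forall>p'\<in>Z. p \<noteq> p' \<longrightarrow> cr p p' \<noteq> 0)"

lemma exists_line_through:
  assumes "cr u p \<noteq> 0"
  shows "\<exists>f\<in>form 1. f u = 0 \<and> f p \<noteq> 0"
proof -
  obtain w where "det3 u p w \<noteq> 0" using assms cr_nonzero_iff_det3 by blast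
  then have "det3 w u p \<noteq> 0" by (simp add: det3_rotate[of w])
  then show ?thesis using det3_form[of w u] by (intro bexI[of _ "det3 w u"]) simp_all
qed

text \<open>The form is a product of \<open>m\<close> lines through \<open>q\<close>: the joins of
  \<open>q\<close> with the points of \<open>Y\<close>, filled up with lines through
  \<open>q\<close> that miss \<open>p\<close>.\<close>

lemma exists_lines_through_multiple_point:
  assumes "finite Y" "card Y \<le> m" "\<And>y. y \<in> Y \<Longrightarrow> det3 y q p \<noteq> 0" "cr q p \<noteq> 0"
  shows "\<exists>g\<in>ext_mform m m q. g p \<noteq> 0 \<and> (\<forall>y\<in>Y. g y = 0)"
  using assms(1-3)
proof (induction m arbitrary: Y)
  case 0
  then show ?case using one_ext_mform by (intro bexI[of _ "\<lambda>_. 1"]) auto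
next
  case (Suc m)
  obtain s where s: "det3 s q p \<noteq> 0" "card (Y - {s}) \<le> m"
  proof (cases "Y = {}")
    case True
    \<comment> \<open>No point is left to be covered, so any line through \<open>q\<close> that
      misses \<open>p\<close> fills the degree.\<close>
    obtain w where "det3 q p w \<noteq> 0" using assms(4) cr_nonzero_iff_det3 by blast
    then have "det3 w q p \<noteq> 0" by (simp add: det3_rotate[of w])
    with True that[of w] show ?thesis by simp
  next
    case False
    then obtain s where "s \<in> Y" by blast
    with Suc.prems that[of s] show ?thesis by simp
  qed
  have "\<exists>g\<in>ext_mform m m q. g p \<noteq> 0 \<and> (\<forall>y\<in>Y - {s}. g y = 0)"
    using Suc.prems s by (intro Suc.IH) auto
  then obtain g where g: "g \<in> ext_mform m m q" "g p \<noteq> 0" "\<forall>y\<in>Y - {s}. g y = 0" by blast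
  have "(\<lambda>x. det3 s q x * g x) \<in> ext_mform (1 + m) (Suc m) q"
    by (intro ext_mform_mult det3_ext_mform g)
  with s g show ?case by (intro bexI[of _ "\<lambda>x. det3 s q x * g x"]) auto
qed

text \<open>A form of degree \<open>d\<close> with \<open>d + 1\<close> zeros on a line vanishes on
  the whole line, so it cannot be nonzero at one further point there.\<close>

lemma collinear_separated_card:
  assumes "finite Y" "distinct_points Y" "separates (form d) Y"
    and col: "\<And>p p' p''. p \<in> Y \<Longrightarrow> p' \<in> Y \<Longrightarrow> p'' \<in> Y \<Longrightarrow> det3 p p' p'' = 0"
  shows "card Y \<le> d + 1"
proof (rule ccontr)
  assume *: "\<not> card Y \<le> d + 1"
  then have "card Y \<ge> 2" by simp
  then obtain u w where uw: "u \<in> Y" "w \<in> Y" "u \<noteq> w"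
    by (metis card_2_iff' card_le_Suc0_iff_eq not_less_eq_eq numeral_2_eq_2 assms(1))
  have cr: "cr u w \<noteq> 0" using uw assms(2) by (auto simp: distinct_points_def)
  obtain f where f: "f \<in> form d" "f u = 1" "\<forall>p\<in>Y - {u}. f p = 0"
    using assms(3) uw unfolding separates_def by blast
  \<comment> \<open>On the line, \<open>u\<close> serves as the point at infinity and the other
    points get the affine parameter \<open>s\<close>.\<close>
  have "\<exists>s c. c \<noteq> 0 \<and> p = c *s (w + s *s u)" if p: "p \<in> Y - {u}" for p
  proof -
    obtain a b where ab: "p = a *s u + b *s w"
      using det3_zero_imp_span[OF cr col[of u w p]] uw p by blast
    have "b \<noteq> 0"
    proof
      assume "b = 0"
      with ab have "cr u p = 0" by (simp add: vec_eq_iff forall_3 cr_def vector_3)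
      with p uw assms(2) show False by (auto simp: distinct_points_def)
    qed
    with ab have "p = b *s (w + (a / b) *s u)"
      by (simp add: vec_eq_iff field_simps)
    with \<open>b \<noteq> 0\<close> show ?thesis by blast
  qed
  then obtain s c where sc: "\<And>p. p \<in> Y - {u} \<Longrightarrow> c p \<noteq> 0 \<and> p = c p *s (w + s p *s u)"
    by metis
  obtain P where P: "degree P \<le> d" "\<And>t. f (w + t *s u) = poly P t"
    using f(1) poly3_eval_on_line[of d _ w u] unfolding form_def by auto
  have inj: "inj_on s (Y - {u})"
  proof (rule inj_onI, rule ccontr)
    fix p p' assume p: "p \<in> Y - {u}" "p' \<in> Y - {u}" "s p = s p'" "p \<noteq> p'"
    let ?x = "w + s p *s u"
    have "p = c p *s ?x" using sc[OF p(1)] by blast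
    moreover have "p' = c p' *s ?x" using sc[OF p(2)] p(3) by simp
    ultimately have "cr p p' = cr (c p *s ?x) (c p' *s ?x)" by simp
    also have "\<dots> = 0"
      by (simp add: vec_eq_iff forall_3 cr_def vector_3) (simp add: algebra_simps)
    finally have "cr p p' = 0" .
    with p assms(2) show False by (auto simp: distinct_points_def)
  qed
  have "poly P (s p) = 0" if "p \<in> Y - {u}" for p
  proof -
    have "0 = f (c p *s (w + s p *s u))" using f(3) sc that by metis
    also have "\<dots> = c p ^ d * poly P (s p)" by (simp only: form_smult[OF f(1)] P(2))
    finally show ?thesis using sc that by simp
  qed
  then have "s ` (Y - {u}) \<subseteq> {t. poly P t = 0}" by auto
  then have le: "card (s ` (Y - {u})) \<le> card {t. poly P t = 0}" if "P \<noteq> 0"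
    using poly_roots_finite[OF that] by (intro card_mono)
  have "card (s ` (Y - {u})) > d"
    using * uw assms(1) inj by (simp add: card_image)
  with le P(1) have "P = 0"
    using card_poly_roots_bound[of P] by linarith
  \<comment> \<open>The polynomial \<open>P\<close> does not see \<open>u\<close> itself. In the
    opposite chart, centred at \<open>u\<close>, the form vanishes for all
    \<open>t \<noteq> 0\<close> and hence also at \<open>u\<close>.\<close>
  obtain R where R: "\<And>t. f (u + t *s w) = poly R t"
    using f(1) poly3_eval_on_line[of d _ u w] unfolding form_def by auto
  have "poly R t = 0" if "t \<noteq> 0" for t
  proof -
    have "u + t *s w = t *s (w + (1 / t) *s u)" using that by (simp add: vec_eq_iff field_simps)
    then have "f (u + t *s w) = t ^ d * f (w + (1 / t) *s u)" using form_smult[OF f(1)] by metis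
    then show ?thesis using P(2) R \<open>P = 0\<close> by simp
  qed
  then have "- {0} \<subseteq> {t. poly R t = 0}" by auto
  moreover have "infinite (- {0 :: complex})" by (simp add: infinite_UNIV_char_0 Compl_eq_Diff_UNIV)
  ultimately have "R = 0" using poly_roots_finite[of R] finite_subset[of "- {0}" "{t. poly R t = 0}"] by blast
  then show False using R[of 0] f(2) by simp
qed

text \<open>The points split into \<open>A\<close> off the line through \<open>u\<close> and
  \<open>w\<close> and \<open>B\<close> on it. The line annihilates \<open>B\<close> while
  separating within \<open>A\<close>; afterwards \<open>B\<close> only has to be separated within
  itself. Every other factor except one passes through \<open>q\<close>.\<close>

lemma exists_separating_point_collinear:
  assumes "finite Z" "distinct_points Z" "separates (form j) Z" "0 < j"
    and uw: "u \<in> Z" "w \<in> Z" "u \<noteq> w" and few: "card {p\<in>Z. det3 u w p \<noteq> 0} \<le> j"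
  shows "\<exists>q. q \<noteq> 0 \<and> separates (ext_mform j (j - 1) q) Z"
proof -
  define A where "A = {p\<in>Z. det3 u w p \<noteq> 0}"
  define B where "B = {p\<in>Z. det3 u w p = 0}"
  have AB: "Z = A \<union> B" "A \<inter> B = {}" "finite A" "finite B" using assms(1) by (auto simp: A_def B_def)
  have cr: "cr p p' \<noteq> 0" if "p \<in> Z" "p' \<in> Z" "p \<noteq> p'" for p p'
    using assms(2) that by (auto simp: distinct_points_def)
  have "card B \<le> j + 1"
  proof (rule collinear_separated_card)
    fix p p' p'' assume p: "p \<in> B" "p' \<in> B" "p'' \<in> B"
    have "cr u w \<noteq> 0" using cr uw by auto
    then show "det3 p p' p'' = 0"
      using p det3_zero_imp_span[of u w] unfolding B_def
      by (smt (verit, best) mem_Collect_eq det3_trans det3_rotate det3_add_smult det3_same mult_zero_right add_0)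
  qed (use AB assms separates_subset[OF assms(3)] in \<open>auto simp: distinct_points_def\<close>)
  \<comment> \<open>The point \<open>q\<close> is chosen off all lines joining two points of
    \<open>Z\<close>, so a line from \<open>q\<close> contains at most one of them.\<close>
  let ?P = "{(p, p') \<in> Z \<times> Z. p \<noteq> p'}"
  have "finite ?P" by (rule finite_subset[of _ "Z \<times> Z"]) (use assms(1) in auto)
  then have "\<exists>q. \<forall>a\<in>(\<lambda>(p, p'). cr p p') ` ?P. dot a q \<noteq> 0"
    using cr by (intro exists_avoiding_planes) auto
  then obtain q where q: "\<And>p p'. p \<in> Z \<Longrightarrow> p' \<in> Z \<Longrightarrow> p \<noteq> p' \<Longrightarrow> det3 p p' q \<noteq> 0"
    by (fastforce simp: det3_def)
  have q': "det3 p q p' \<noteq> 0" if "p \<in> Z" "p' \<in> Z" "p \<noteq> p'" for p p'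
    using q[of p' p] that det3_rotate by metis
  have crq: "cr q p \<noteq> 0" if "p \<in> Z" for p
  proof -
    obtain p' where "p' \<in> Z" "p' \<noteq> p" using uw by metis
    then have "det3 q p p' \<noteq> 0" using q'[of p' p] that det3_rotate by metis
    then show ?thesis using cr_nonzero_iff_det3 by blast
  qed
  have "separates (ext_mform j (j - 1) q) (A \<union> B)"
  proof (rule separates_triangular[OF lin_closed_ext_mform AB(3) _ _ AB(2)])
    fix p assume p: "p \<in> A"
    \<comment> \<open>At most \<open>j - 1\<close> points of \<open>A\<close> remain, one line
      through \<open>q\<close> for each.\<close>
    have "\<exists>g\<in>ext_mform (j - 1) (j - 1) q. g p \<noteq> 0 \<and> (\<forall>y\<in>A - {p}. g y = 0)"
      using p AB few crq q' unfolding A_def[symmetric]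
      by (intro exists_lines_through_multiple_point) auto
    then obtain g where g: "g \<in> ext_mform (j - 1) (j - 1) q" "g p \<noteq> 0" "\<forall>y\<in>A - {p}. g y = 0"
      by blast
    have "(\<lambda>x. det3 u w x * g x) \<in> ext_mform (1 + (j - 1)) (j - 1) q"
      by (intro ext_mform_form_mult det3_form g)
    with g p \<open>0 < j\<close> show "\<exists>f\<in>ext_mform j (j - 1) q. f p \<noteq> 0 \<and> (\<forall>p'\<in>A \<union> B - {p}. f p' = 0)"
      by (intro bexI[of _ "\<lambda>x. det3 u w x * g x"]) (auto simp: A_def B_def)
  next
    fix p assume p: "p \<in> B"
    have "u \<in> B" "w \<in> B" using uw by (auto simp: B_def)
    then obtain p' where p': "p' \<in> B" "p' \<noteq> p" using uw by metis
    \<comment> \<open>\<open>B\<close> may have \<open>j + 1\<close> points. The free line takes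
      care of \<open>p'\<close>, which leaves at most \<open>j - 1\<close> points for the lines
      through \<open>q\<close>.\<close>
    have "\<exists>g\<in>ext_mform (j - 1) (j - 1) q. g p \<noteq> 0 \<and> (\<forall>y\<in>B - {p, p'}. g y = 0)"
      using p p' AB \<open>card B \<le> j + 1\<close> crq q'
      by (intro exists_lines_through_multiple_point) (auto simp: card_Diff_subset)
    then obtain g where g: "g \<in> ext_mform (j - 1) (j - 1) q" "g p \<noteq> 0" "\<forall>y\<in>B - {p, p'}. g y = 0"
      by blast
    obtain f where f: "f \<in> form 1" "f p' = 0" "f p \<noteq> 0"
      using exists_line_through cr[of p' p] p p' AB by blast
    have "(\<lambda>x. f x * g x) \<in> ext_mform (1 + (j - 1)) (j - 1) q"
      by (intro ext_mform_form_mult f g)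
    with g f \<open>0 < j\<close> show "\<exists>f\<in>ext_mform j (j - 1) q. f p \<noteq> 0 \<and> (\<forall>p'\<in>B - {p}. f p' = 0)"
      by (intro bexI[of _ "\<lambda>x. f x * g x"]) auto
  qed
  moreover have "q \<noteq> 0" using crq[OF uw(1)] cr_nonzero_imp by blast
  ultimately show ?thesis using AB by auto
qed

section \<open>Conics\<close>

text \<open>The six points are the basis vectors and their pairwise sums. The mixed monomials single
  out the sums, and a square minus two mixed monomials singles out a basis vector.\<close>

lemma separates_form_2: "\<exists>T. card T = 6 \<and> separates (form 2) T"
proof -
  define e where "e = (\<lambda>a b c :: complex. vector [a, b, c] :: complex ^ 3)"
  have e [simp]: "e a b c $ 1 = a" "e a b c $ 2 = b" "e a b c $ 3 = c" for a b c
    by (simp_all add: e_def vector_3)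
  have eq: "e a b c = e a' b' c' \<longleftrightarrow> a = a' \<and> b = b' \<and> c = c'" for a b c a' b' c'
    by (auto simp: vec_eq_iff forall_3)
  define T where "T = {e 1 0 0, e 0 1 0, e 0 0 1, e 1 1 0, e 1 0 1, e 0 1 1}"
  have X: "(\<lambda>x. x $ i * x $ k) \<in> form 2" for i k :: 3
  proof -
    have "dot (axis i 1) = (\<lambda>x. x $ i)" for i
      by (simp add: dot_axis fun_eq_iff)
    then show ?thesis
      using form_mult[OF dot_form dot_form, of "axis i 1" "axis k 1"] by (simp add: numeral_2_eq_2)
  qed
  have XX: "(\<lambda>x. x $ i * x $ i - 1 * (x $ i * x $ k) - 1 * (x $ i * x $ l)) \<in> form 2" for i k l :: 3
    by (intro lin_closed_diff_scale[OF lin_closed_form] X)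
  have "\<exists>f\<in>form 2. f t = 1 \<and> (\<forall>t'\<in>T - {t}. f t' = 0)" if "t \<in> T" for t
  proof -
    from that consider "t = e 1 1 0" | "t = e 1 0 1" | "t = e 0 1 1" | "t = e 1 0 0" | "t = e 0 1 0" | "t = e 0 0 1"
      unfolding T_def by blast
    then show ?thesis
    proof cases
      case 1
      then show ?thesis by (intro bexI[OF _ X[of 1 2]]) (auto simp: T_def eq)
    next
      case 2
      then show ?thesis by (intro bexI[OF _ X[of 1 3]]) (auto simp: T_def eq)
    next
      case 3
      then show ?thesis by (intro bexI[OF _ X[of 2 3]]) (auto simp: T_def eq)
    next
      case 4
      then show ?thesis by (intro bexI[OF _ XX[of 1 2 3]]) (auto simp: T_def eq)
    next
      case 5
      then show ?thesis by (intro bexI[OF _ XX[of 2 1 3]]) (auto simp: T_def eq)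
    next
      case 6
      then show ?thesis by (intro bexI[OF _ XX[of 3 1 2]]) (auto simp: T_def eq)
    qed
  qed
  then have "separates (form 2) T"
    unfolding separates_def by blast
  moreover have "card T = 6" by (simp add: T_def eq)
  ultimately show ?thesis by blast
qed

text \<open>Five conditions cannot exhaust six independent evaluations on conics.\<close>

lemma exists_conic_through:
  assumes "finite Z" "card Z \<le> 5"
  shows "\<exists>f\<in>form 2. (\<forall>p\<in>Z. f p = 0) \<and> (\<exists>q. f q \<noteq> 0)"
proof -
  obtain T where "card T = 6" "separates (form 2) T" using separates_form_2 by blast
  then show ?thesis
    using exists_vanishing_nonzero[OF assms(1) lin_closed_form, of 2 T] assms(2) by fastforce
qed

text \<open>With \<open>q\<close> off a conic \<open>g\<close> through \<open>Z\<close>, every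
  separating form can be moved through \<open>q\<close> by adding a multiple of \<open>g\<close>,
  which changes nothing on \<open>Z\<close>.\<close>

lemma exists_separating_point_conic:
  assumes "finite Z" "card Z \<le> 5" "separates (form 2) Z"
  shows "\<exists>q. q \<noteq> 0 \<and> separates (ext_mform 2 1 q) Z"
proof -
  obtain g q where g: "g \<in> form 2" "\<forall>p\<in>Z. g p = 0" "g q \<noteq> 0"
    using exists_conic_through[OF assms(1,2)] by blast
  have "q \<noteq> 0" using form_smult[OF g(1), of 0 q] g(3) by auto
  moreover have "separates (ext_mform 2 1 q) Z"
  proof (rule separatesI[OF lin_closed_ext_mform])
    fix p assume "p \<in> Z"
    with assms(3) obtain f where "f \<in> form 2" "f p = 1" "\<forall>p'\<in>Z - {p}. f p' = 0"
      unfolding separates_def by blast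
    with g \<open>p \<in> Z\<close> show "\<exists>f\<in>ext_mform 2 1 q. f p \<noteq> 0 \<and> (\<forall>p'\<in>Z - {p}. f p' = 0)"
      by (intro bexI[OF _ pencil_ext_mform[of f 2 g q]]) auto
  qed
  ultimately show ?thesis by blast
qed

section \<open>Conics and their intersection with a line\<close>

lemma form_2_coefficients:
  assumes "f \<in> form 2"
  shows "\<exists>c :: nat \<Rightarrow> complex. \<forall>x. f x = c 0 * x$1 ^ 2 + c 1 * x$2 ^ 2 + c 2 * x$3 ^ 2
    + c 3 * (x$1 * x$2) + c 4 * (x$1 * x$3) + c 5 * (x$2 * x$3)"
proof -
  obtain F where F: "f = poly3_eval F" "homogeneous 2 F" using assms unfolding form_def by blast
  have "\<exists>c :: nat \<Rightarrow> complex. \<forall>x :: complex ^ 3.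
     (\<Sum>m\<in>A. Poly_Mapping.lookup F m * (\<Prod>i\<in>UNIV. (x $ i) ^ Poly_Mapping.lookup m i)) =
       c 0 * x$1 ^ 2 + c 1 * x$2 ^ 2 + c 2 * x$3 ^ 2
         + c 3 * (x$1 * x$2) + c 4 * (x$1 * x$3) + c 5 * (x$2 * x$3)"
    if "finite A" "A \<subseteq> Poly_Mapping.keys F" for A
    using that
  proof (induction A)
    case empty
    show ?case by (intro exI[of _ "\<lambda>_. 0"]) simp
  next
    case (insert m A)
    then obtain c where IH: "\<And>x :: complex ^ 3.
      (\<Sum>m\<in>A. Poly_Mapping.lookup F m * (\<Prod>i\<in>UNIV. (x $ i) ^ Poly_Mapping.lookup m i)) =
       c 0 * x$1 ^ 2 + c 1 * x$2 ^ 2 + c (2 :: nat) * x$3 ^ 2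
         + c 3 * (x$1 * x$2) + c 4 * (x$1 * x$3) + c 5 * (x$2 * x$3)"
      by auto
    define k where "k = Poly_Mapping.lookup F m"
    define m1 m2 m3 where "m1 = Poly_Mapping.lookup m 1" and "m2 = Poly_Mapping.lookup m 2"
      and "m3 = Poly_Mapping.lookup m 3"
    have *: "(\<Sum>m\<in>insert m A. Poly_Mapping.lookup F m * (\<Prod>i\<in>UNIV. (x $ i) ^ Poly_Mapping.lookup m i)) =
       k * (x$1 ^ m1 * x$2 ^ m2 * x$3 ^ m3) + (c 0 * x$1 ^ 2 + c 1 * x$2 ^ 2 + c 2 * x$3 ^ 2
         + c 3 * (x$1 * x$2) + c 4 * (x$1 * x$3) + c 5 * (x$2 * x$3))" for x :: "complex ^ 3"
    proof -
      have "(\<Prod>i\<in>UNIV. (x $ i) ^ Poly_Mapping.lookup m i) = x$1 ^ m1 * x$2 ^ m2 * x$3 ^ m3"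
        unfolding UNIV_3 m1_def m2_def m3_def by simp
      then show ?thesis
        unfolding sum.insert[OF insert.hyps] IH k_def by simp
    qed
    have sum: "m1 + m2 + m3 = 2"
      using F(2) insert.prems unfolding homogeneous_def m1_def m2_def m3_def by (simp add: sum_3)
    then have "m1 \<le> 2" "m2 \<le> 2" by simp_all
    then have "m1 \<in> {0, 1, 2}" "m2 \<in> {0, 1, 2}" by auto
    with sum have "m1 = 2 \<and> m2 = 0 \<and> m3 = 0 \<or> m1 = 0 \<and> m2 = 2 \<and> m3 = 0 \<or> m1 = 0 \<and> m2 = 0 \<and> m3 = 2 \<or>
      m1 = 1 \<and> m2 = 1 \<and> m3 = 0 \<or> m1 = 1 \<and> m2 = 0 \<and> m3 = 1 \<or> m1 = 0 \<and> m2 = 1 \<and> m3 = 1"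
      by - (elim insertE emptyE, simp_all)
    then show ?case
      unfolding *
    proof (elim disjE conjE, goal_cases)
      case 1 then show ?case by (intro exI[of _ "c(0 := c 0 + k)"]) (simp add: algebra_simps)
    next
      case 2 then show ?case by (intro exI[of _ "c(1 := c 1 + k)"]) (simp add: algebra_simps)
    next
      case 3 then show ?case by (intro exI[of _ "c(2 := c 2 + k)"]) (simp add: algebra_simps)
    next
      case 4 then show ?case by (intro exI[of _ "c(3 := c 3 + k)"]) (simp add: algebra_simps)
    next
      case 5 then show ?case by (intro exI[of _ "c(4 := c 4 + k)"]) (simp add: algebra_simps)
    next
      case 6 then show ?case by (intro exI[of _ "c(5 := c 5 + k)"]) (simp add: algebra_simps)
    qed
  qed
  from this[of "Poly_Mapping.keys F"] show ?thesis
    unfolding F(1) poly3_eval_def by auto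
qed

text \<open>\<open>B\<close> is the polar bilinear form \<open>f (u + v) - f u - f v\<close>. The
  explicit coefficients turn both expansions into ring identities.\<close>

lemma form_2_polarization:
  assumes "f \<in> form 2"
  obtains B where
    "\<And>u v a b. f (a *s u + b *s v) = a ^ 2 * f u + a * b * B u v + b ^ 2 * f v"
    "\<And>u v w a b c. f (a *s u + b *s v + c *s w) = a ^ 2 * f u + b ^ 2 * f v + c ^ 2 * f w
       + a * b * B u v + a * c * B u w + b * c * B v w"
proof -
  obtain c :: "nat \<Rightarrow> complex" where k: "\<And>x. f x = c 0 * x$1 ^ 2 + c 1 * x$2 ^ 2 + c 2 * x$3 ^ 2
    + c 3 * (x$1 * x$2) + c 4 * (x$1 * x$3) + c 5 * (x$2 * x$3)"
    using form_2_coefficients[OF assms] by blast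
  show thesis
    by (rule that[of "\<lambda>u v. f (u + v) - f u - f v"])
       (simp_all add: k algebra_simps power2_eq_square)
qed

lemma det3_perm: "det3 y z x = det3 x y z" "det3 z x y = det3 x y z"
  "det3 y x z = - det3 x y z" "det3 x z y = - det3 x y z" "det3 z y x = - det3 x y z"
  by (simp_all add: det3_expand) (simp_all add: algebra_simps)

lemma det3_nonzero_cr: "det3 u v w \<noteq> 0 \<Longrightarrow> cr u v \<noteq> 0"
  using cr_nonzero_iff_det3 by blast

text \<open>Otherwise the line is a component of the conic, and the residual line would contain the
  noncollinear points \<open>a\<close>, \<open>b\<close>, \<open>c\<close>. The polar form replaces
  the factorization.\<close>

lemma finite_conic_inter_line:
  assumes f: "f \<in> form 2" "f x \<noteq> 0" "f a = 0" "f b = 0" "f c = 0" and "det3 a b c \<noteq> 0"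
    and off: "det3 u v a \<noteq> 0" "det3 u v b \<noteq> 0" "det3 u v c \<noteq> 0"
  shows "finite {t. f (u + t *s v) = 0}"
proof -
  obtain P where P: "\<And>t. f (u + t *s v) = poly P t"
    using f(1) poly3_eval_on_line[of 2 _ u v] unfolding form_def by blast
  obtain B where B: "\<And>u v a b. f (a *s u + b *s v) = a ^ 2 * f u + a * b * B u v + b ^ 2 * f v"
    and B3: "\<And>u v w a b c. f (a *s u + b *s v + c *s w) = a ^ 2 * f u + b ^ 2 * f v + c ^ 2 * f w
       + a * b * B u v + a * c * B u w + b * c * B v w"
    using form_2_polarization[OF f(1)] by blast
  have "P \<noteq> 0"
  proof
    assume "P = 0"
    have 0: "f u + t * B u v + t ^ 2 * f v = 0" for t
      using B[of 1 u t v] P[of t] \<open>P = 0\<close> by simp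
    \<comment> \<open>The parameters 0, 1 and -1 determine the three coefficients of the quadratic
      polynomial.\<close>
    have "f u = 0" "f v = 0" "B u v = 0"
      using 0[of 0] 0[of 1] 0[of "- 1"] by (auto simp: algebra_simps)
    then have line: "f y = 0" if "det3 u v y = 0" for y
      using det3_zero_imp_span[OF det3_nonzero_cr[OF off(1)] that] B by auto
    \<comment> \<open>The line through \<open>y\<close> and \<open>z\<close> meets the line of
      \<open>u\<close> and \<open>v\<close> in a third zero of \<open>f\<close>, different from
      \<open>y\<close> and \<open>z\<close>, so the mixed term vanishes.\<close>
    have B0: "B y z = 0" if "f y = 0" "f z = 0" "det3 u v y \<noteq> 0" "det3 u v z \<noteq> 0" for y z
    proof -
      have "f (det3 u v z *s y + (- det3 u v y) *s z) = 0"
        by (rule line) (simp only: det3_add_smult, simp)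
      with that show ?thesis unfolding B by simp
    qed
    have "f (det3 a b c *s x) = 0"
      unfolding cramer3[of a b c x] B3 using f off B0 by simp
    then show False using form_smult[OF f(1), of "det3 a b c" x] f(2) assms(6) by simp
  qed
  then show ?thesis unfolding P by (rule poly_roots_finite)
qed

text \<open>Since distinct vectors are compared, a set of at least four vectors with this property
  also contains no two proportional ones.\<close>

definition no_four_collinear :: "(complex ^ 3) set \<Rightarrow> bool" where
  "no_four_collinear Z \<longleftrightarrow> (\<forall>a\<in>Z. \<forall>b\<in>Z. \<forall>c\<in>Z. \<forall>d\<in>Z. distinct [a, b, c, d] \<longrightarrow>
     det3 a b c \<noteq> 0 \<or> det3 a b d \<noteq> 0)"

lemma no_four_collinearD:
  assumes "no_four_collinear Z" "a \<in> Z" "b \<in> Z" "c \<in> Z" "d \<in> Z" "distinct [a, b, c, d]"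
    "det3 a b c = 0"
  shows "det3 a b d \<noteq> 0"
  using assms unfolding no_four_collinear_def by blast

lemma no_four_collinear_subset: "no_four_collinear Z \<Longrightarrow> Y \<subseteq> Z \<Longrightarrow> no_four_collinear Y"
  unfolding no_four_collinear_def by blast

text \<open>If \<open>p\<close> lay on two joins with a common point, four points would be
  collinear. So if \<open>p\<close> lies on one of \<open>ab\<close>, \<open>cd\<close>, it lies on
  neither \<open>ac\<close> nor \<open>bd\<close>, since each of these shares a point with
  both.\<close>

lemma line_pair_avoiding:
  assumes "no_four_collinear {a, b, c, d, p}" "distinct [a, b, c, d, p]"
  shows "\<exists>f\<in>form 2. f p \<noteq> 0 \<and> (\<forall>y\<in>{a, b, c, d}. f y = 0)"
proof -
  have N: "\<not> (det3 x y p = 0 \<and> det3 x z p = 0)"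
    if "x \<in> {a, b, c, d}" "y \<in> {a, b, c, d}" "z \<in> {a, b, c, d}" "distinct [x, y, z]" for x y z
    using no_four_collinearD[OF assms(1), of x p y z] that assms(2)
    by (auto simp: det3_perm(4)[of x _ p])
  have *: "(\<lambda>x. det3 u v x * det3 u' v' x) \<in> form 2" for u v u' v'
    using form_mult[OF det3_form det3_form] by (simp add: numeral_2_eq_2)
  show ?thesis
  proof (cases "det3 a b p = 0 \<or> det3 c d p = 0")
    case False
    then show ?thesis by (intro bexI[OF _ *[of a b c d]]) auto
  next
    case True
    then have "det3 a c p \<noteq> 0 \<and> det3 b d p \<noteq> 0"
      using N[of a b c] N[of b a d] N[of c a d] N[of d b c] assms(2)
      by (auto simp: det3_perm(3)[of a b] det3_perm(3)[of a c] det3_perm(3)[of c d] det3_perm(3)[of b d])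
    then show ?thesis by (intro bexI[OF _ *[of a c b d]]) auto
  qed
qed

lemma obtain_distinct_4:
  assumes "4 \<le> card Y"
  obtains a b c d where "a \<in> Y" "b \<in> Y" "c \<in> Y" "d \<in> Y" "distinct [a, b, c, d]"
proof -
  obtain X where X: "X \<subseteq> Y" "card X = 4"
    using assms by (meson obtain_subset_with_card_n)
  then have "finite X" by (auto intro: card_ge_0_finite)
  then obtain xs where "set xs = X" "distinct xs" using finite_distinct_list by blast
  with X have "length xs = 4" using distinct_card by metis
  then obtain a b c d where "xs = [a, b, c, d]"
    by (auto simp: length_Suc_conv numeral_eq_Suc)
  with \<open>set xs = X\<close> \<open>distinct xs\<close> X that show ?thesis by auto
qed

text \<open>Take a line pair \<open>f\<close> through the four points that misses \<open>p\<close>,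
  and a conic \<open>g\<close> through all five. The member of their pencil through \<open>q\<close>
  has the value \<open>g q * f p\<close> at \<open>p\<close>, and \<open>g\<close> has finitely many
  zeros on the line because the line is not a component of it.\<close>

lemma finite_no_conic_avoiding:
  assumes Y: "card Y = 5" "no_four_collinear Y" "p \<in> Y"
    and off: "\<And>y. y \<in> Y \<Longrightarrow> det3 u v y \<noteq> 0"
  shows "finite {t. \<not> (\<exists>g\<in>ext_mform 2 1 (u + t *s v). g p \<noteq> 0 \<and> (\<forall>y\<in>Y - {p}. g y = 0))}"
proof -
  have "finite Y" using Y(1) by (auto intro: card_ge_0_finite)
  have "4 \<le> card (Y - {p})" using Y \<open>finite Y\<close> by simp
  then obtain a b c d where abcd: "a \<in> Y - {p}" "b \<in> Y - {p}" "c \<in> Y - {p}" "d \<in> Y - {p}"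
    "distinct [a, b, c, d]"
    by (rule obtain_distinct_4)
  have eq: "Y - {p} = {a, b, c, d}"
    by (rule card_subset_eq[symmetric]) (use abcd Y \<open>finite Y\<close> in auto)
  then have "Y = {a, b, c, d, p}" using Y(3) by blast
  then obtain f where f: "f \<in> form 2" "f p \<noteq> 0" "\<forall>y\<in>Y - {p}. f y = 0"
    using line_pair_avoiding[of a b c d p] Y(2) abcd eq by auto
  obtain g x where g: "g \<in> form 2" "\<forall>y\<in>Y. g y = 0" "g x \<noteq> 0"
    using exists_conic_through[OF \<open>finite Y\<close>] Y(1) by auto
  \<comment> \<open>One of the triples \<open>a, b, c\<close> and \<open>a, b, d\<close> is not
    collinear.\<close>
  have "finite {t. g (u + t *s v) = 0}"
  proof (cases "det3 a b c = 0")
    case True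
    then have "det3 a b d \<noteq> 0"
      using no_four_collinearD[OF Y(2), of a b c d] abcd by auto
    then show ?thesis
      using finite_conic_inter_line[OF g(1,3), of a b d] g abcd off by auto
  next
    case False
    then show ?thesis
      using finite_conic_inter_line[OF g(1,3), of a b c] g abcd off by auto
  qed
  moreover have "\<exists>h\<in>ext_mform 2 1 (u + t *s v). h p \<noteq> 0 \<and> (\<forall>y\<in>Y - {p}. h y = 0)"
    if "g (u + t *s v) \<noteq> 0" for t
    using that f g Y(3) by (intro bexI[OF _ pencil_ext_mform[of f 2 g]]) auto
  ultimately show ?thesis by (elim finite_subset[rotated]) blast
qed

section \<open>Lines through exactly two points\<close>

lemma even_card_fixpoint_free_involution:
  assumes "finite A" "\<And>x. x \<in> A \<Longrightarrow> T x \<in> A \<and> T x \<noteq> x \<and> T (T x) = x"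
  shows "even (card A)"
  using assms
proof (induction A rule: finite_psubset_induct)
  case (psubset A)
  show ?case
  proof (cases "A = {}")
    case False
    then obtain x where x: "x \<in> A" by blast
    have "even (card (A - {x, T x}))"
    proof (rule psubset.IH)
      show "A - {x, T x} \<subset> A" using x by blast
    next
      fix y assume y: "y \<in> A - {x, T x}"
      then have "T y \<noteq> x" "T y \<noteq> T x" using psubset.prems[of y] psubset.prems[OF x] by auto
      then show "T y \<in> A - {x, T x} \<and> T y \<noteq> y \<and> T (T y) = y" using psubset.prems[of y] y by auto
    qed
    moreover have "card A = card (A - {x, T x}) + 2"
    proof -
      have "{x, T x} \<subseteq> A" "card {x, T x} = 2" using psubset.prems[OF x] x by auto
      then show ?thesis
        using psubset.hyps card_mono[of A "{x, T x}"] by (simp add: card_Diff_subset)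
    qed
    ultimately show ?thesis by simp
  qed simp
qed

lemma det3_combination:
  "det3 (x1 *s a + x2 *s b + x3 *s c) (y1 *s a + y2 *s b + y3 *s c) (z1 *s a + z2 *s b + z3 *s c) =
   (x1 * (y2 * z3 - y3 * z2) - x2 * (y1 * z3 - y3 * z1) + x3 * (y1 * z2 - y2 * z1)) * det3 a b c"
  by (simp add: det3_expand) algebra

text \<open>The Fano plane is not realizable in characteristic other than two. This is the only step where
  the characteristic matters: seven points forming a Fano plane do admit unexpected
  cubics in characteristic two.\<close>

lemma complete_quadrilateral_diagonals:
  assumes "det3 a b c \<noteq> 0" "det3 a b d = 0" "det3 b c e = 0" "det3 a c f = 0"
    "det3 c d g = 0" "det3 a e g = 0" "det3 b f g = 0" "det3 d e f = 0"
    "det3 b c d \<noteq> 0" "det3 b c g \<noteq> 0" "det3 a c e \<noteq> 0" "det3 a c g \<noteq> 0" "det3 a b f \<noteq> 0" "det3 a b g \<noteq> 0"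
  shows False
proof -
  let ?D = "det3 a b c"
  have comb: "\<exists>x1 x2 x3. x = x1 *s a + x2 *s b + x3 *s c" for x
  proof -
    have "x = (1 / ?D) *s (?D *s x)" using assms(1) by simp
    also have "\<dots> = (det3 x b c / ?D) *s a + (det3 a x c / ?D) *s b + (det3 a b x / ?D) *s c"
      unfolding cramer3[of a b c x] by (simp add: vec.scale_right_distrib)
    finally show ?thesis by blast
  qed
  obtain d1 d2 d3 where d: "d = d1 *s a + d2 *s b + d3 *s c" using comb by blast
  obtain e1 e2 e3 where e: "e = e1 *s a + e2 *s b + e3 *s c" using comb by blast
  obtain f1 f2 f3 where f: "f = f1 *s a + f2 *s b + f3 *s c" using comb by blast
  obtain g1 g2 g3 where g: "g = g1 *s a + g2 *s b + g3 *s c" using comb by blast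
  have abc: "a = 1 *s a + 0 *s b + 0 *s c" "b = 0 *s a + 1 *s b + 0 *s c" "c = 0 *s a + 0 *s b + 1 *s c"
    by simp_all
  \<comment> \<open>In coordinates with respect to the triangle \<open>a, b, c\<close>, the points
    \<open>d\<close>, \<open>e\<close>, \<open>f\<close> on its sides each lose one
    coordinate.\<close>
  have "d3 = 0" using assms(1,2) det3_combination[of 1 a 0 b 0 c 0 1 0 d1 d2 d3] d by simp
  have "e1 = 0" using assms(1,3) det3_combination[of 0 a 1 b 0 c 0 0 1 e1 e2 e3] e by simp
  have "f2 = 0" using assms(1,4) det3_combination[of 1 a 0 b 0 c 0 0 1 f1 f2 f3] f by simp
  \<comment> \<open>The lines from the vertices to \<open>d\<close>, \<open>e\<close>,
    \<open>f\<close> meet in \<open>g\<close>. Multiplying the three relations gives Ceva's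
    condition.\<close>
  have 1: "d1 * g2 = d2 * g1"
    using assms(1,5) det3_combination[of 0 a 0 b 1 c d1 d2 d3 g1 g2 g3] d g \<open>d3 = 0\<close> by simp
  have 2: "e2 * g3 = e3 * g2"
    using assms(1,6) det3_combination[of 1 a 0 b 0 c e1 e2 e3 g1 g2 g3] e g \<open>e1 = 0\<close> by simp
  have 3: "f3 * g1 = f1 * g3"
    using assms(1,7) det3_combination[of 0 a 1 b 0 c f1 f2 f3 g1 g2 g3] f g \<open>f2 = 0\<close> by simp
  \<comment> \<open>Collinearity of \<open>d\<close>, \<open>e\<close>, \<open>f\<close> is
    Menelaus' condition, which differs from Ceva's by a sign.\<close>
  have "(d1 * e2 * f3 + d2 * e3 * f1) * det3 a b c = 0"
    using assms(1,8) det3_combination[of d1 a d2 b d3 c e1 e2 e3 f1 f2 f3] d e f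
      \<open>d3 = 0\<close> \<open>e1 = 0\<close> \<open>f2 = 0\<close> by (simp add: algebra_simps)
  then have 4: "d1 * e2 * f3 + d2 * e3 * f1 = 0" using assms(1) by simp
  have nz: "d1 \<noteq> 0" "g1 \<noteq> 0" "e2 \<noteq> 0" "g2 \<noteq> 0" "f3 \<noteq> 0" "g3 \<noteq> 0"
    using assms(9-14) det3_combination[of 0 a 1 b 0 c 0 0 1 d1 d2 d3]
      det3_combination[of 0 a 1 b 0 c 0 0 1 g1 g2 g3] det3_combination[of 1 a 0 b 0 c 0 0 1 e1 e2 e3]
      det3_combination[of 1 a 0 b 0 c 0 0 1 g1 g2 g3] det3_combination[of 1 a 0 b 0 c 0 1 0 f1 f2 f3]
      det3_combination[of 1 a 0 b 0 c 0 1 0 g1 g2 g3] d e f g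
    by auto
  have "d1 * e2 * f3 * (g1 * g2 * g3) = d2 * e3 * f1 * (g1 * g2 * g3)"
    using 1 2 3 by algebra
  then have "d1 * e2 * f3 = d2 * e3 * f1" using nz by simp
  with 4 have "2 * (d1 * e2 * f3) = 0" by (metis mult_2)
  with nz show False by simp
qed

text \<open>If every joining line had a third point, it would have exactly three, and the seven
  points would form a Fano plane. This is recovered from a triangle \<open>a, b, c\<close>, the
  third points \<open>d, e, f\<close> on its sides, and the remaining point
  \<open>g\<close>.\<close>

lemma exists_two_point_line_7:
  assumes "card Z = 7" and N: "no_four_collinear Z"
  shows "\<exists>u\<in>Z. \<exists>v\<in>Z. u \<noteq> v \<and> (\<forall>p\<in>Z - {u, v}. det3 u v p \<noteq> 0)"
proof (rule ccontr)
  assume "\<not> ?thesis"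
  then have third: "\<exists>p\<in>Z - {u, v}. det3 u v p = 0" if "u \<in> Z" "v \<in> Z" "u \<noteq> v" for u v
    using that by blast
  have fin: "finite Z" using assms(1) by (auto intro: card_ge_0_finite)
  have no4: "\<not> (det3 x y z = 0 \<and> det3 x y w = 0)"
    if "x \<in> Z" "y \<in> Z" "z \<in> Z" "w \<in> Z" "distinct [x, y, z, w]" for x y z w
    using no_four_collinearD[OF N, of x y z w] that by blast
  have sym: "det3 y x z = 0 \<longleftrightarrow> det3 x y z = 0" "det3 x z y = 0 \<longleftrightarrow> det3 x y z = 0" for x y z
    by (metis det3_perm(3) neg_equal_0_iff_equal, metis det3_perm(4) neg_equal_0_iff_equal)
  have "4 \<le> card Z" using assms(1) by simp
  then obtain a b x y where "a \<in> Z" "b \<in> Z" "x \<in> Z" "y \<in> Z" "distinct [a, b, x, y]"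
    by (rule obtain_distinct_4)
  then have ab: "a \<in> Z" "b \<in> Z" "a \<noteq> b" by auto
  obtain d where d: "d \<in> Z" "d \<noteq> a" "d \<noteq> b" "det3 a b d = 0" using third ab by blast
  have "card {a, b, d} < card Z" using assms(1) card_insert_le_m1[of 3 "{b, d}" a] by (simp add: card_insert_if)
  then obtain c where c: "c \<in> Z" "c \<noteq> a" "c \<noteq> b" "c \<noteq> d"
    using card_mono[of "{a, b, d}" Z] by fastforce
  have abc: "det3 a b c \<noteq> 0" using no4[of a b d c] ab c d by auto
  obtain e where e: "e \<in> Z" "e \<noteq> b" "e \<noteq> c" "det3 b c e = 0" using third[of b c] ab c by auto
  obtain f where f: "f \<in> Z" "f \<noteq> a" "f \<noteq> c" "det3 a c f = 0" using third[of a c] ab c by auto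
  have "e \<noteq> a" using e abc by (metis det3_perm(1))
  moreover have "e \<noteq> d" using no4[of b d a c] ab c d e sym by (metis distinct_length_2_or_more distinct_singleton)
  moreover have "f \<noteq> b" using f abc sym by metis
  moreover have "f \<noteq> d" using no4[of a d b c] ab c d f sym by (metis distinct_length_2_or_more distinct_singleton)
  moreover have "f \<noteq> e" using no4[of c e a b] ab c e f sym \<open>e \<noteq> a\<close>
    by (metis distinct_length_2_or_more distinct_singleton)
  ultimately have dist: "distinct [a, b, c, d, e, f]" using ab c d e f by auto
  have "card (set [a, b, c, d, e, f]) = 6" using distinct_card[OF dist] by simp
  then obtain g where g: "g \<in> Z" "g \<notin> set [a, b, c, d, e, f]"
    using assms(1) card_mono[of "set [a, b, c, d, e, f]" Z] by fastforce
  have dist7: "distinct [a, b, c, d, e, f, g]" using dist g by auto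
  have "set [a, b, c, d, e, f, g] = Z"
    using distinct_card[OF dist7] assms(1) ab c d e f g fin by (intro card_subset_eq) auto
  then have Z: "Z = {a, b, c, d, e, f, g}" by simp
  have no4': "False" if "x \<in> Z" "y \<in> Z" "z \<in> Z" "w \<in> Z" "distinct [x, y, z, w]"
    "det3 x y z = 0" "det3 x y w = 0" for x y z w
    using no4 that by blast
  note mem = ab c(1) d(1) e(1) f(1) g(1)
  \<comment> \<open>Some third point lies on the line through \<open>c\<close> and \<open>d\<close>.
    Each candidate other than \<open>g\<close> would put a fourth point on a line already known to
    have three; the other lines are found in the same way.\<close>
  have "det3 c d g = 0"
  proof -
    obtain h where h: "h \<in> Z - {c, d}" "det3 c d h = 0" using third[of c d] mem dist7 by auto
    have "h \<noteq> a" using no4'[of a d c b] h d mem dist7 sym by auto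
    moreover have "h \<noteq> b" using no4'[of b d c a] h d mem dist7 sym by auto
    moreover have "h \<noteq> e" using no4'[of c e d b] h e mem dist7 sym by auto
    moreover have "h \<noteq> f" using no4'[of c f d a] h f mem dist7 sym by auto
    ultimately show ?thesis using h Z by auto
  qed
  moreover have "det3 a e g = 0"
  proof -
    obtain h where h: "h \<in> Z - {a, e}" "det3 a e h = 0" using third[of a e] mem dist7 by auto
    have "h \<noteq> b" using no4'[of b e a c] h e mem dist7 sym by auto
    moreover have "h \<noteq> c" using no4'[of c e a b] h e mem dist7 sym by auto
    moreover have "h \<noteq> d" using no4'[of a d e b] h d mem dist7 sym by auto
    moreover have "h \<noteq> f" using no4'[of a f e c] h f mem dist7 sym by auto
    ultimately show ?thesis using h Z by auto
  qed
  moreover have "det3 b f g = 0"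
  proof -
    obtain h where h: "h \<in> Z - {b, f}" "det3 b f h = 0" using third[of b f] mem dist7 by auto
    have "h \<noteq> a" using no4'[of a f b c] h f mem dist7 sym by auto
    moreover have "h \<noteq> c" using no4'[of c f b a] h f mem dist7 sym by auto
    moreover have "h \<noteq> d" using no4'[of b d f a] h d mem dist7 sym by auto
    moreover have "h \<noteq> e" using no4'[of b e f c] h e mem dist7 sym by auto
    ultimately show ?thesis using h Z by auto
  qed
  moreover have "det3 d e f = 0"
  proof -
    obtain h where h: "h \<in> Z - {d, e}" "det3 d e h = 0" using third[of d e] mem dist7 by auto
    have "h \<noteq> a" using no4'[of a d e b] h d mem dist7 sym by auto
    moreover have "h \<noteq> b" using no4'[of b d e a] h d mem dist7 sym by auto
    moreover have "h \<noteq> c" using no4'[of c e d b] h e mem dist7 sym by auto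
    moreover have "h \<noteq> g" using no4'[of d g e c] h \<open>det3 c d g = 0\<close> mem dist7 sym by auto
    ultimately show ?thesis using h Z by auto
  qed
  ultimately show False
    using complete_quadrilateral_diagonals[of a b c d e f g] abc d e f
      no4[of b c e d] no4[of b c e g] no4[of a c f e] no4[of a c f g] no4[of a b d f] no4[of a b d g]
      mem dist7 by auto
qed

text \<open>If every line through a fixed \<open>u\<close> and another point had exactly one more
  point, the lines through \<open>u\<close> would pair off the remaining seven points, an odd
  number.\<close>

lemma exists_two_point_line_8:
  assumes "card Z = 8" and N: "no_four_collinear Z"
  shows "\<exists>u\<in>Z. \<exists>v\<in>Z. u \<noteq> v \<and> (\<forall>p\<in>Z - {u, v}. det3 u v p \<noteq> 0)"
proof (rule ccontr)
  assume "\<not> ?thesis"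
  then have third: "\<exists>p\<in>Z - {u, v}. det3 u v p = 0" if "u \<in> Z" "v \<in> Z" "u \<noteq> v" for u v
    using that by blast
  have fin: "finite Z" using assms(1) by (auto intro: card_ge_0_finite)
  obtain u where u: "u \<in> Z" using assms(1) by fastforce
  obtain T where T: "\<And>x. x \<in> Z - {u} \<Longrightarrow> T x \<in> Z - {u, x} \<and> det3 u x (T x) = 0"
    using third[OF u] by (metis Diff_iff insertI1)
  have "even (card (Z - {u}))"
  proof (rule even_card_fixpoint_free_involution[of _ T])
    fix x assume x: "x \<in> Z - {u}"
    have Tx: "T x \<in> Z - {u}" using T[OF x] by blast
    \<comment> \<open>Otherwise \<open>u\<close>, \<open>x\<close>, \<open>T x\<close> and
      \<open>T (T x)\<close> would be four collinear points.\<close>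
    have "T (T x) = x"
    proof (rule ccontr)
      assume "T (T x) \<noteq> x"
      then show False
        using no_four_collinearD[OF N, of u "T x" "T (T x)" x] T[OF x] T[OF Tx] x u
          det3_perm(4)[of u x "T x"] by auto
    qed
    then show "T x \<in> Z - {u} \<and> T x \<noteq> x \<and> T (T x) = x" using T[OF x] by blast
  qed (use fin in simp)
  moreover have "card (Z - {u}) = 7" using assms(1) u fin by simp
  ultimately show False by simp
qed

section \<open>Points without four collinear ones\<close>

text \<open>Points are added one at a time, each off all lines joining two of the earlier ones, so a
  new point lies on no line with three points.\<close>

lemma exists_extension_no_four_collinear:
  assumes "finite Z" "distinct_points Z" "no_four_collinear Z" "card Z \<le> n"
  shows "\<exists>Z'. finite Z' \<and> Z \<subseteq> Z' \<and> card Z' = n \<and> no_four_collinear Z'"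
  using assms
proof (induction "n - card Z" arbitrary: Z)
  case 0
  then show ?case by (intro exI[of _ Z]) auto
next
  case (Suc k)
  let ?P = "{(p, p') \<in> Z \<times> Z. p \<noteq> p'}"
  have cr: "cr p p' \<noteq> 0" if "p \<in> Z" "p' \<in> Z" "p \<noteq> p'" for p p'
    using Suc.prems(2) that by (auto simp: distinct_points_def)
  \<comment> \<open>A line through \<open>p\<close> and such a \<open>w\<close> is also avoided by
    the new point, which keeps it different from \<open>p\<close>.\<close>
  have "\<exists>w. cr p w \<noteq> 0" if "p \<in> Z" for p
  proof -
    have "p \<noteq> 0" using Suc.prems(2) that by (auto simp: distinct_points_def)
    then obtain i where "p $ i \<noteq> 0" by (auto simp: vec_eq_iff)
    then show ?thesis
      using exhaust_3[of i] \<open>p \<noteq> 0\<close>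
      by (intro exI[of _ "if i = 1 then axis 2 1 else axis 1 1"])
         (auto simp: vec_eq_iff forall_3 cr_def vector_3 axis_def)
  qed
  then obtain w where w: "\<And>p. p \<in> Z \<Longrightarrow> cr p (w p) \<noteq> 0" by metis
  have "finite ?P" by (rule finite_subset[of _ "Z \<times> Z"]) (use Suc.prems in auto)
  \<comment> \<open>The coordinate plane \<open>axis 1 1\<close> is included to guarantee
    \<open>q \<noteq> 0\<close> even when \<open>Z\<close> is empty.\<close>
  then have "\<exists>q. \<forall>a\<in>insert (axis 1 1) ((\<lambda>(p, p'). cr p p') ` ?P \<union> (\<lambda>p. cr p (w p)) ` Z). dot a q \<noteq> 0"
    using cr w Suc.prems by (intro exists_avoiding_planes) (auto simp: axis_eq_0_iff)
  then obtain q where q: "\<And>p p'. p \<in> Z \<Longrightarrow> p' \<in> Z \<Longrightarrow> p \<noteq> p' \<Longrightarrow> det3 p p' q \<noteq> 0"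
    "\<And>p. p \<in> Z \<Longrightarrow> det3 p (w p) q \<noteq> 0" "dot (axis 1 1) q \<noteq> 0"
    by (fastforce simp: det3_def)
  have "q \<noteq> 0" using q(3) by (auto simp: dot_def)
  have "q \<notin> Z" using q(2) by (metis det3_same(2))
  have crq: "cr p q \<noteq> 0" "cr q p \<noteq> 0" if "p \<in> Z" for p
  proof -
    have "det3 p q (w p) \<noteq> 0" using q(2)[OF that] by (simp add: det3_perm(4)[of p "w p" q])
    then show "cr p q \<noteq> 0" by (rule det3_nonzero_cr)
    then show "cr q p \<noteq> 0" by (simp add: cr_eq_0_commute)
  qed
  have "distinct_points (insert q Z)"
    using Suc.prems(2) \<open>q \<noteq> 0\<close> crq unfolding distinct_points_def by auto
  moreover have "no_four_collinear (insert q Z)"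
    unfolding no_four_collinear_def
  proof (intro ballI impI)
    fix a b c d assume *: "a \<in> insert q Z" "b \<in> insert q Z" "c \<in> insert q Z" "d \<in> insert q Z" "distinct [a, b, c, d]"
    then consider "a = q" | "b = q" | "c = q" | "d = q" | "a \<in> Z" "b \<in> Z" "c \<in> Z" "d \<in> Z" by blast
    then show "det3 a b c \<noteq> 0 \<or> det3 a b d \<noteq> 0"
    proof cases
      case 1
      then have "det3 b c q \<noteq> 0" using * q(1) by auto
      then show ?thesis using 1 by (simp add: det3_perm(1)[of b c q])
    next
      case 2
      then have "det3 a c q \<noteq> 0" using * q(1) by auto
      then show ?thesis using 2 by (simp add: det3_perm(4)[of a q c])
    next
      case 3
      then show ?thesis using * q(1)[of a b] by auto
    next
      case 4
      then show ?thesis using * q(1)[of a b] by auto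
    next
      case 5
      then show ?thesis using * Suc.prems(3) unfolding no_four_collinear_def by blast
    qed
  qed
  ultimately have "\<exists>Z'. finite Z' \<and> insert q Z \<subseteq> Z' \<and> card Z' = n \<and> no_four_collinear Z'"
    using Suc.prems Suc.hyps(2) \<open>q \<notin> Z\<close> by (intro Suc.hyps(1)) auto
  then show ?case by auto
qed

text \<open>Choosing \<open>q\<close> on the line of \<open>u\<close> and \<open>v\<close> makes
  this line do double duty: it removes \<open>u\<close> and \<open>v\<close> and contributes one to
  the multiplicity at \<open>q\<close>. The conic removes four points at the cost of degree two, so
  at most \<open>j - 3\<close> points are left for lines.\<close>

lemma exists_separating_point_two_point_line:
  assumes "finite Z" and N: "no_four_collinear Z" and "7 \<le> card Z" "card Z \<le> j + 4"
    and uv: "u \<in> Z" "v \<in> Z" "u \<noteq> v" "\<And>p. p \<in> Z - {u, v} \<Longrightarrow> det3 u v p \<noteq> 0"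
  shows "\<exists>q. q \<noteq> 0 \<and> separates (ext_mform j (j - 1) q) Z"
proof -
  define A where "A = Z - {u, v}"
  have "card A = card Z - 2" using uv assms(1) by (simp add: A_def card_Diff_subset)
  have A: "finite A" "A \<subseteq> Z" "card A \<ge> 5" "card A \<le> j + 2" "j \<ge> 3"
    using assms uv \<open>card A = card Z - 2\<close> by (auto simp: A_def)
  have off: "det3 u v p \<noteq> 0" if "p \<in> A" for p using that uv by (simp add: A_def)
  define q where "q = (\<lambda>t. u + t *s v)"
  \<comment> \<open>Parameters for which no conic through \<open>q t\<close> passes through the
    other four points of \<open>Y\<close> and misses \<open>p\<close>.\<close>
  define bad where "bad = (\<lambda>(Y, p). {t. \<not> (\<exists>g\<in>ext_mform 2 1 (q t). g p \<noteq> 0 \<and> (\<forall>y\<in>Y - {p}. g y = 0))})"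
  define I where "I = {(Y, p). Y \<subseteq> A \<and> card Y = 5 \<and> p \<in> Y}"
  have "finite (\<Union>i\<in>I. bad i)"
  proof (rule finite_UN_I)
    show "finite I" by (rule finite_subset[of _ "Pow A \<times> A"]) (use A in \<open>auto simp: I_def\<close>)
    show "finite (bad i)" if "i \<in> I" for i
    proof -
      obtain Y p where Y: "i = (Y, p)" "Y \<subseteq> A" "card Y = 5" "p \<in> Y" using \<open>i \<in> I\<close> unfolding I_def by blast
      have "no_four_collinear Y" using N Y(2) A(2) by (meson no_four_collinear_subset)
      then show ?thesis
        unfolding Y(1) bad_def q_def prod.case using Y off by (intro finite_no_conic_avoiding) auto
    qed
  qed
  moreover have "finite (\<Union>(p, p')\<in>{(p, p') \<in> A \<times> A. p \<noteq> p'}. {t. det3 p p' (q t) = 0})"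
  proof (rule finite_UN_I)
    show "finite {(p, p') \<in> A \<times> A. p \<noteq> p'}"
      by (rule finite_subset[of _ "A \<times> A"]) (use A in auto)
    fix i assume "i \<in> {(p, p') \<in> A \<times> A. p \<noteq> p'}"
    then obtain p p' where p: "i = (p, p')" "p \<in> A" "p' \<in> A" "p \<noteq> p'" by auto
    have eq: "det3 p p' (q t) = poly [:det3 p p' u, det3 p p' v:] t" for t
      using det3_add_smult[of p p' 1 u t v] by (simp add: q_def)
    \<comment> \<open>The line through \<open>p\<close> and \<open>p'\<close> cannot contain both
      \<open>u\<close> and \<open>v\<close>, so it meets their line in a single point, which
      \<open>q t\<close> has to avoid.\<close>
    have "[:det3 p p' u, det3 p p' v:] \<noteq> 0"
      using no_four_collinearD[OF N, of p p' u v] p uv by (auto simp: A_def)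
    from poly_roots_finite[OF this] show "finite (case i of (p, p') \<Rightarrow> {t. det3 p p' (q t) = 0})"
      unfolding p prod.case eq .
  qed
  ultimately have "finite ({0} \<union> (\<Union>i\<in>I. bad i) \<union> (\<Union>(p, p')\<in>{(p, p') \<in> A \<times> A. p \<noteq> p'}. {t. det3 p p' (q t) = 0}))"
    by simp
  from ex_new_if_finite[OF infinite_UNIV_char_0 this] obtain t where t: "t \<noteq> 0" "t \<notin> (\<Union>i\<in>I. bad i)"
    "t \<notin> (\<Union>(p, p')\<in>{(p, p') \<in> A \<times> A. p \<noteq> p'}. {t. det3 p p' (q t) = 0})"
    by blast
  have conic: "\<exists>g\<in>ext_mform 2 1 (q t). g p \<noteq> 0 \<and> (\<forall>y\<in>Y - {p}. g y = 0)"
    if "Y \<subseteq> A" "card Y = 5" "p \<in> Y" for Y p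
    using t(2) that unfolding I_def bad_def by blast
  have lines: "det3 p (q t) p' \<noteq> 0" if "p \<in> A" "p' \<in> A" "p \<noteq> p'" for p p'
    using t(3) that det3_perm(4)[of p "q t" p'] by auto
  \<comment> \<open>For \<open>t \<noteq> 0\<close> the line of \<open>u\<close> and
    \<open>v\<close> is also the join of \<open>u\<close> with \<open>q t\<close>. In this form it
    deforms together with \<open>q t\<close>, as \<open>ext_mform\<close> requires.\<close>
  have qx: "det3 u (q t) x = t * det3 u v x" "det3 (q t) v x = det3 u v x" for x
    by (simp_all add: q_def det3_expand algebra_simps)
  have "A \<noteq> {}" using A(3) by auto
  then obtain p\<^sub>0 where p0: "det3 u v p\<^sub>0 \<noteq> 0" using off by blast
  have cruv: "cr (q t) u \<noteq> 0" "cr (q t) v \<noteq> 0" "cr u v \<noteq> 0" "cr v u \<noteq> 0"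
    using det3_nonzero_cr[of u "q t" p\<^sub>0] det3_nonzero_cr[of "q t" v p\<^sub>0] det3_nonzero_cr[of u v p\<^sub>0]
      qx p0 t(1) cr_eq_0_commute by auto
  have "separates (ext_mform j (j - 1) (q t)) (A \<union> {u, v})"
  proof (rule separates_triangular[OF lin_closed_ext_mform A(1)])
    fix p assume p: "p \<in> A"
    have "4 \<le> card (A - {p})" using A p by simp
    then obtain Y where Y: "Y \<subseteq> A - {p}" "card Y = 4" by (meson obtain_subset_with_card_n)
    have finY: "finite Y" using Y A by (meson finite_Diff finite_subset)
    have "p \<notin> Y" using Y(1) by blast
    then have "insert p Y - {p} = Y" "card (insert p Y) = 5" using Y(2) finY by auto
    then obtain g where g: "g \<in> ext_mform 2 1 (q t)" "g p \<noteq> 0" "\<forall>y\<in>Y. g y = 0"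
      using conic[of "insert p Y" p] Y(1) p by auto
    have "det3 (q t) v p \<noteq> 0" using qx off p by simp
    then have "det3 (q t) p v \<noteq> 0" by (simp add: det3_perm(4)[of "q t" v p])
    then have "cr (q t) p \<noteq> 0" by (rule det3_nonzero_cr)
    moreover have "card (A - insert p Y) \<le> j - 3"
      using A Y p finY by (simp add: card_Diff_subset card_insert_if subset_Diff_insert)
    ultimately have "\<exists>h\<in>ext_mform (j - 3) (j - 3) (q t). h p \<noteq> 0 \<and> (\<forall>y\<in>A - insert p Y. h y = 0)"
      using A p lines by (intro exists_lines_through_multiple_point) auto
    then obtain h where h: "h \<in> ext_mform (j - 3) (j - 3) (q t)" "h p \<noteq> 0" "\<forall>y\<in>A - insert p Y. h y = 0"
      by blast
    \<comment> \<open>Line, conic and \<open>j - 3\<close> further lines: degree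
      \<open>1 + 2 + (j - 3) = j\<close> and multiplicity
      \<open>1 + 1 + (j - 3) = j - 1\<close>.\<close>
    have "(\<lambda>x. det3 u (q t) x * (g x * h x)) \<in> ext_mform (1 + (2 + (j - 3))) (Suc (Suc (j - 3))) (q t)"
      by (intro ext_mform_mult det3_ext_mform g h)
    moreover have "1 + (2 + (j - 3)) = j" "Suc (Suc (j - 3)) = j - 1" using A by auto
    ultimately show "\<exists>f\<in>ext_mform j (j - 1) (q t). f p \<noteq> 0 \<and> (\<forall>p'\<in>A \<union> {u, v} - {p}. f p' = 0)"
      using g h p off t(1) by (intro bexI[of _ "\<lambda>x. det3 u (q t) x * (g x * h x)"]) (auto simp: qx)
  next
    fix p assume p: "p \<in> {u, v}"
    then obtain p' where p': "{u, v} - {p} = {p'}" "cr p' p \<noteq> 0" using cruv uv(3) by blast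
    \<comment> \<open>Within \<open>{u, v}\<close>, the lines through \<open>q t\<close> only have
      to miss \<open>p\<close>; one free line removes the other point.\<close>
    have "\<exists>h\<in>ext_mform (j - 1) (j - 1) (q t). h p \<noteq> 0 \<and> (\<forall>y\<in>{}. h y = 0)"
      using p cruv by (intro exists_lines_through_multiple_point) auto
    then obtain h where h: "h \<in> ext_mform (j - 1) (j - 1) (q t)" "h p \<noteq> 0" by blast
    obtain f where f: "f \<in> form 1" "f p' = 0" "f p \<noteq> 0" using exists_line_through p' by blast
    have "(\<lambda>x. f x * h x) \<in> ext_mform (1 + (j - 1)) (j - 1) (q t)"
      by (intro ext_mform_form_mult f h)
    with f h A p' show "\<exists>f\<in>ext_mform j (j - 1) (q t). f p \<noteq> 0 \<and> (\<forall>p'\<in>{u, v} - {p}. f p' = 0)"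
      by (intro bexI[of _ "\<lambda>x. f x * h x"]) auto
  qed (auto simp: A_def)
  moreover have "A \<union> {u, v} = Z" using uv by (auto simp: A_def)
  moreover have "q t \<noteq> 0" using cruv(1) cr_nonzero_imp by blast
  ultimately show ?thesis by auto
qed

lemma exists_separating_point:
  assumes "finite Z" "distinct_points Z" "separates (form j) Z" "2 \<le> j" "card Z \<le> 8" "card Z \<le> 2 * j + 1"
  shows "\<exists>q. q \<noteq> 0 \<and> separates (ext_mform j (j - 1) q) Z"
proof -
  consider "j = 2" | "j \<ge> 3" "no_four_collinear Z" | "j \<ge> 3" "\<not> no_four_collinear Z"
    using assms(4) by linarith
  then show ?thesis
  proof cases
    case 1
    then show ?thesis using exists_separating_point_conic assms by simp
  next
    case 2
    \<comment> \<open>For \<open>j = 3\<close> the bound \<open>2 * j + 1\<close> gives at most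
      seven points. The value of \<open>n\<close> has to satisfy \<open>7 \<le> n\<close> and
      \<open>n \<le> j + 4\<close>.\<close>
    define n :: nat where "n = (if j = 3 then 7 else 8)"
    have "card Z \<le> n" using assms by (auto simp: n_def)
    then obtain Z' where Z': "finite Z'" "Z \<subseteq> Z'" "card Z' = n" "no_four_collinear Z'"
      using exists_extension_no_four_collinear assms 2 by blast
    have "\<exists>u\<in>Z'. \<exists>v\<in>Z'. u \<noteq> v \<and> (\<forall>p\<in>Z' - {u, v}. det3 u v p \<noteq> 0)"
      using exists_two_point_line_7[of Z'] exists_two_point_line_8[of Z'] Z' by (auto simp: n_def split: if_splits)
    moreover have "7 \<le> card Z'" "card Z' \<le> j + 4" using Z' 2 by (auto simp: n_def)
    ultimately obtain q where "q \<noteq> 0" "separates (ext_mform j (j - 1) q) Z'"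
      using exists_separating_point_two_point_line[OF Z'(1,4)] by blast
    with separates_subset Z'(2) show ?thesis by blast
  next
    case 3
    then obtain a b c d where abcd: "a \<in> Z" "b \<in> Z" "c \<in> Z" "d \<in> Z" "distinct [a, b, c, d]"
      "det3 a b c = 0" "det3 a b d = 0"
      unfolding no_four_collinear_def by blast
    \<comment> \<open>With four points on a line, at most
      \<open>min 8 (2 * j + 1) - 4 \<le> j\<close> points lie off it.\<close>
    have "{p \<in> Z. det3 a b p \<noteq> 0} \<subseteq> Z - {a, b, c, d}" using abcd by auto
    then have "card {p \<in> Z. det3 a b p \<noteq> 0} \<le> card (Z - {a, b, c, d})"
      using assms(1) by (intro card_mono) auto
    also have "\<dots> = card Z - 4" using abcd assms(1) by (simp add: card_Diff_subset)
    also have "\<dots> \<le> j" using assms 3 by linarith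
    finally show ?thesis
      using exists_separating_point_collinear[of Z j a b] assms abcd 3 by auto
  qed
qed

section \<open>Dimensions\<close>

text \<open>The functionals \<open>\<phi> k\<close> vanish on \<open>V\<close> and are dual to the
  forms \<open>G k\<close>, so these forms are independent modulo \<open>V\<close>.\<close>

lemma poly3_dim_add_card_le:
  assumes "V \<subseteq> S" "finite T" "S \<subseteq> poly3.span T" "finite K" "\<And>k. k \<in> K \<Longrightarrow> G k \<in> S"
    and add: "\<And>k F F'. \<phi> k (F + F') = \<phi> k F + \<phi> k F'"
    and scale: "\<And>k c F. \<phi> k (poly3_scale c F) = c * \<phi> k F"
    and zero: "\<And>k F. k \<in> K \<Longrightarrow> F \<in> V \<Longrightarrow> \<phi> k F = (0 :: complex)"
    and diag: "\<And>k k'. k \<in> K \<Longrightarrow> k' \<in> K \<Longrightarrow> \<phi> k (G k') = (if k = k' then 1 else 0)"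
  shows "poly3_dim V + card K \<le> poly3_dim S"
proof -
  \<comment> \<open>An infinite basis would have \<open>card\<close> equal to 0, so finiteness is
    secured through the finite spanning set.\<close>
  have fin: "finite X" if "poly3.independent X" "X \<subseteq> S" for X
    using poly3.independent_span_bound[OF \<open>finite T\<close> that(1)] that(2) assms(3) by blast
  obtain B where B: "B \<subseteq> V" "poly3.independent B" "V \<subseteq> poly3.span B" "card B = poly3_dim V"
    using poly3.basis_exists by blast
  have "finite B" using fin B assms(1) by blast
  have "poly3.independent (B \<union> G ` L) \<and> card (B \<union> G ` L) = card B + card L" if "L \<subseteq> K" "finite L" for L
    using that(2,1)
  proof (induction L)
    case (insert k L)
    \<comment> \<open>\<open>\<phi> k\<close> kills \<open>V\<close> and all the other forms
      \<open>G k'\<close> but not \<open>G k\<close>, so \<open>G k\<close> is outside their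
      span.\<close>
    have vanish: "\<phi> k F = 0" if "F \<in> poly3.span (B \<union> G ` L)" for F
      using that
    proof (induction F rule: poly3.span_induct_alt)
      case base
      show ?case using scale[of k 0 0] by simp
    next
      case (step c F F')
      have k: "k \<in> K" "L \<subseteq> K" "k \<notin> L" using insert.hyps insert.prems by auto
      from step(1) have "\<phi> k F = 0"
      proof
        assume "F \<in> B"
        then show ?thesis using zero k(1) B(1) by blast
      next
        assume "F \<in> G ` L"
        then obtain k' where k': "k' \<in> L" "F = G k'" by blast
        then have "k' \<in> K" "k \<noteq> k'" using k by auto
        then show ?thesis using diag[OF k(1), of k'] k'(2) by simp
      qed
      with step show ?case by (simp add: add scale)
    qed
    have "\<phi> k (G k) = 1" using diag[of k k] insert.prems by simp
    then have *: "G k \<notin> poly3.span (B \<union> G ` L)" using vanish by force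
    have IH: "poly3.independent (B \<union> G ` L)" "card (B \<union> G ` L) = card B + card L"
      using insert.IH insert.prems by blast+
    have "G k \<notin> B \<union> G ` L" by (rule contrapos_nn[OF *], rule poly3.span_base)
    then have "card (insert (G k) (B \<union> G ` L)) = card B + card (insert k L)"
      using \<open>finite B\<close> insert.hyps IH(2) by simp
    moreover have "poly3.independent (insert (G k) (B \<union> G ` L))"
      using IH(1) * by (simp only: poly3.independent_insert) simp
    ultimately show ?case by simp
  qed (use B in simp)
  from this[of K] have C: "poly3.independent (B \<union> G ` K)" "card (B \<union> G ` K) = poly3_dim V + card K"
    using assms(4) B(4) by auto
  have "B \<union> G ` K \<subseteq> S" using B(1) assms(1,5) by blast
  then obtain D where D: "B \<union> G ` K \<subseteq> D" "D \<subseteq> S" "poly3.independent D" "S \<subseteq> poly3.span D"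
    using poly3.maximal_independent_subset_extend C(1) by metis
  have "card (B \<union> G ` K) \<le> card D" using D fin by (intro card_mono) auto
  also have "card D = poly3_dim S" using poly3.basis_card_eq_dim D by blast
  finally show ?thesis using C(2) by simp
qed

lemma card_pairs_sum_le: "card {(a :: nat, b). a + b \<le> n} = (n + 2) choose 2"
proof -
  have "{(a :: nat, b). a + b \<le> n} = Sigma {..n} (\<lambda>a. {..n - a})" by auto
  then have "card {(a :: nat, b). a + b \<le> n} = (\<Sum>a\<le>n. Suc (n - a))" by simp
  also have "\<dots> = (\<Sum>a\<le>n. Suc a)"
    using sum.nat_diff_reindex[of Suc "Suc n"] by (simp add: lessThan_Suc_atMost)
  also have "\<dots> = (n + 2) choose 2"
    by (induction n) (simp_all add: numeral_2_eq_2)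
  finally show ?thesis .
qed

lemma finite_pairs_sum_le: "finite {(a :: nat, b). a + b \<le> n}"
  by (rule finite_subset[of _ "{..n} \<times> {..n}"]) auto

text \<open>The monomials of degree \<open>j\<close> span, and each is determined by its first two
  exponents.\<close>

lemma homogeneous_subset_span:
  "\<exists>T. finite T \<and> card T \<le> (j + 2) choose 2 \<and> {F. homogeneous j F} \<subseteq> poly3.span T"
proof -
  define M where "M = {m :: 3 \<Rightarrow>\<^sub>0 nat. (\<Sum>i\<in>UNIV. Poly_Mapping.lookup m i) = j}"
  define h where "h = (\<lambda>m :: 3 \<Rightarrow>\<^sub>0 nat. (Poly_Mapping.lookup m 1, Poly_Mapping.lookup m 2))"
  have inj: "inj_on h M"
  proof (rule inj_onI)
    fix m m' assume "m \<in> M" "m' \<in> M" "h m = h m'"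
    then have "\<forall>i. Poly_Mapping.lookup m i = Poly_Mapping.lookup m' i"
      unfolding forall_3 by (simp add: M_def h_def sum_3)
    then show "m = m'" by (intro poly_mapping_eqI) blast
  qed
  have sub: "h ` M \<subseteq> {(a, b). a + b \<le> j}"
    by (auto simp: M_def h_def sum_3)
  have finM: "finite M"
    using inj finite_subset[OF sub finite_pairs_sum_le] by (rule finite_imageD[rotated])
  let ?T = "(\<lambda>m. Poly_Mapping.single m (1 :: complex)) ` M"
  have "card ?T \<le> card M" using finM by (rule card_image_le)
  also have "\<dots> \<le> card {(a :: nat, b). a + b \<le> j}"
    by (rule card_inj_on_le[OF inj sub finite_pairs_sum_le])
  finally have "card ?T \<le> (j + 2) choose 2" by (simp only: card_pairs_sum_le)
  moreover have "F \<in> poly3.span ?T" if "homogeneous j F" for F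
  proof -
    have "(\<Sum>m\<in>Poly_Mapping.keys F. Poly_Mapping.single m (Poly_Mapping.lookup F m)) \<in> poly3.span ?T"
    proof (rule poly3.span_sum)
      fix m assume "m \<in> Poly_Mapping.keys F"
      then have "m \<in> M" using that by (simp add: homogeneous_def M_def)
      then have "poly3_scale (Poly_Mapping.lookup F m) (Poly_Mapping.single m 1) \<in> poly3.span ?T"
        by (intro poly3.span_scale poly3.span_base) auto
      then show "Poly_Mapping.single m (Poly_Mapping.lookup F m) \<in> poly3.span ?T"
        by (simp add: poly3_scale_def mult_single)
    qed
    then show ?thesis by (simp add: poly_mapping_eq_sum_single)
  qed
  ultimately show ?thesis using finM by (intro exI[of _ ?T]) auto
qed

section \<open>Taylor coefficients of a form\<close>

lemma foldr_partial_deriv_add: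
  "foldr partial_deriv ks (F + G) = foldr partial_deriv ks F + foldr partial_deriv ks G"
  by (induction ks) (auto simp: partial_deriv_add)

lemma foldr_partial_deriv_scale:
  "foldr partial_deriv ks (poly3_scale c F) = poly3_scale c (foldr partial_deriv ks F)"
  by (induction ks) (auto simp: partial_deriv_scale)

lemma partial_deriv_power:
  "partial_deriv k (F ^ n) = of_nat n * F ^ (n - 1) * partial_deriv k F"
proof (induction n)
  case (Suc n)
  then show ?case by (cases n) (simp_all add: partial_deriv_mult algebra_simps)
qed simp

lemma poly3_scale_of_nat: "poly3_scale (of_nat n) F = of_nat n * F"
  by (simp add: poly3_scale_def single_of_nat)

text \<open>\<open>H\<close> is constant in the differentiated variable. The product is a falling
  factorial; for \<open>r > n\<close> it contains the factor 0, so the truncated exponent does no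
  harm.\<close>

lemma foldr_partial_deriv_replicate:
  assumes "partial_deriv k X = 1" "partial_deriv k H = 0"
  shows "foldr partial_deriv (replicate r k) (H * X ^ n) =
    poly3_scale (of_nat (\<Prod>i<r. n - i)) (H * X ^ (n - r))"
proof (induction r)
  case (Suc r)
  have "partial_deriv k (H * X ^ (n - r)) = poly3_scale (of_nat (n - r)) (H * X ^ (n - Suc r))"
    using assms by (simp add: partial_deriv_mult partial_deriv_power poly3_scale_of_nat algebra_simps)
  with Suc show ?case by (simp add: partial_deriv_scale del: of_nat_mult of_nat_diff) (simp add: mult.commute)
qed simp

text \<open>The Taylor monomials at \<open>v\<close> in the chart \<open>x\<^sub>i = 1\<close>, homogenized to degree \<open>j\<close>.\<close>

lemma exists_taylor_forms:
  fixes v :: "complex ^ 3"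
  assumes "v $ i = 1"
  shows "\<exists>M ks c. \<forall>a b. a + b \<le> j \<longrightarrow> homogeneous j (M a b) \<and> c a b \<noteq> (0 :: complex) \<and>
    length (ks a b) = a + b \<and> i \<notin> set (ks a b) \<and>
    (\<forall>a' b'. poly3_eval (foldr partial_deriv (ks a b) (M a' b')) v = (if a = a' \<and> b = b' then c a b else 0))"
proof -
  obtain k l where kl: "k \<noteq> i" "l \<noteq> i" "k \<noteq> l"
  proof -
    from exhaust_3[of i] consider "i = 1" | "i = 2" | "i = 3" by blast
    then show thesis
    proof cases
      case 1 then show ?thesis using that[of 2 3] by simp
    next
      case 2 then show ?thesis using that[of 1 3] by simp
    next
      case 3 then show ?thesis using that[of 1 2] by simp
    qed
  qed
  \<comment> \<open>On the chart, \<open>P\<close> becomes 1, and \<open>X\<close> and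
    \<open>Y\<close> become the local coordinates centred at \<open>v\<close>.\<close>
  define P X Y where "P = lin (axis i 1)"
    and "X = lin (axis k 1 - (v $ k) *s axis i 1)" and "Y = lin (axis l 1 - (v $ l) *s axis i 1)"
  have der: "partial_deriv k P = 0" "partial_deriv l P = 0" "partial_deriv k X = 1"
    "partial_deriv l X = 0" "partial_deriv k Y = 0" "partial_deriv l Y = 1"
    using kl by (simp_all add: P_def X_def Y_def partial_deriv_lin axis_def)
  have ev: "poly3_eval P v = 1" "poly3_eval X v = 0" "poly3_eval Y v = 0"
    using assms by (simp_all add: P_def X_def Y_def poly3_eval_lin dot_axis dot_diff_smult)
  define M where "M = (\<lambda>a b. P ^ (j - a - b) * Y ^ b * X ^ a)"
  define ks where "ks = (\<lambda>a b. replicate b l @ replicate a k)"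
  define ff where "ff = (\<lambda>n r. of_nat (\<Prod>i<r. n - i) :: complex)"
  \<comment> \<open>A derivative of too low order leaves a factor vanishing at \<open>v\<close>, one
    of too high order has coefficient 0; only \<open>0 ^ 0 = 1\<close> survives.\<close>
  have ff: "ff n r * 0 ^ (n - r) = (if n = r then ff n n else 0)" for n r
  proof (cases n r rule: linorder_cases)
    case less
    then have "(\<Prod>i<r. n - i) = 0" by (intro prod_zero) auto
    with less show ?thesis by (simp add: ff_def)
  qed auto
  have "foldr partial_deriv (ks a b) (M a' b') =
      poly3_scale (ff a' a) (poly3_scale (ff b' b) (P ^ (j - a' - b') * X ^ (a' - a) * Y ^ (b' - b)))"
    for a b a' b'
  proof -
    have "foldr partial_deriv (replicate a k) (M a' b') =
        poly3_scale (ff a' a) (P ^ (j - a' - b') * Y ^ b' * X ^ (a' - a))"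
      unfolding M_def ff_def
      by (rule foldr_partial_deriv_replicate) (simp_all add: der partial_deriv_mult partial_deriv_power)
    also have "P ^ (j - a' - b') * Y ^ b' * X ^ (a' - a) = P ^ (j - a' - b') * X ^ (a' - a) * Y ^ b'"
      by (simp add: mult_ac)
    finally have 1: "foldr partial_deriv (replicate a k) (M a' b') =
        poly3_scale (ff a' a) (P ^ (j - a' - b') * X ^ (a' - a) * Y ^ b')" .
    have "foldr partial_deriv (replicate b l) (P ^ (j - a' - b') * X ^ (a' - a) * Y ^ b') =
        poly3_scale (ff b' b) (P ^ (j - a' - b') * X ^ (a' - a) * Y ^ (b' - b))"
      unfolding ff_def
      by (rule foldr_partial_deriv_replicate) (simp_all add: der partial_deriv_mult partial_deriv_power)
    with 1 show ?thesis by (simp only: ks_def foldr_append foldr_partial_deriv_scale)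
  qed
  then have "poly3_eval (foldr partial_deriv (ks a b) (M a' b')) v =
      (ff a' a * 0 ^ (a' - a)) * (ff b' b * 0 ^ (b' - b))" for a b a' b'
    by (simp add: poly3_eval_scale poly3_eval_mult poly3_eval_power ev)
  then have "poly3_eval (foldr partial_deriv (ks a b) (M a' b')) v =
      (if a = a' \<and> b = b' then ff a a * ff b b else 0)" for a b a' b'
    by (simp add: ff)
  moreover have "homogeneous j (M a b)" if "a + b \<le> j" for a b
  proof -
    have "homogeneous ((j - a - b) * 1 + b * 1 + a * 1) (M a b)"
      unfolding M_def P_def X_def Y_def
      by (intro homogeneous_mult homogeneous_power homogeneous_lin)
    with that show ?thesis by simp
  qed
  moreover have "ff a a * ff b b \<noteq> 0" for a b by (simp add: ff_def)
  moreover have "length (ks a b) = a + b" "i \<notin> set (ks a b)" for a b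
    using kl by (auto simp: ks_def)
  ultimately show ?thesis
    by (intro exI[of _ M] exI[of _ ks] exI[of _ "\<lambda>a b. ff a a * ff b b"]) blast
qed

lemma separating_polynomials:
  assumes "separates (mform d m q) Y"
  shows "\<exists>E. \<forall>p\<in>Y. homogeneous d (E p) \<and> (\<forall>c. vanish_ord m (E p) (c *s q)) \<and>
    (\<forall>p'\<in>Y. poly3_eval (E p) p' = (if p = p' then 1 else 0))"
proof (rule bchoice, rule ballI)
  fix p assume "p \<in> Y"
  with assms obtain f where f: "f \<in> mform d m q" "f p = 1" "\<forall>p'\<in>Y - {p}. f p' = 0"
    unfolding separates_def by blast
  from f(1) obtain F where "f = poly3_eval F" "homogeneous d F" "\<forall>c. vanish_ord m F (c *s q)"
    unfolding mform_def by blast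
  with f show "\<exists>F. homogeneous d F \<and> (\<forall>c. vanish_ord m F (c *s q)) \<and>
    (\<forall>p'\<in>Y. poly3_eval F p' = (if p = p' then 1 else 0))" by (intro exI[of _ F]) auto
qed

text \<open>The Taylor coefficients of order at most \<open>j - 2\<close> at \<open>q\<close> vanish
  on forms of multiplicity \<open>j - 1\<close>. Separation keeps them independent on
  \<open>S\<close>, so the multiple point costs its full number of conditions.\<close>

lemma poly3_dim_multiple_point_le:
  assumes q: "\<And>c. c \<noteq> 0 \<Longrightarrow> c *s q \<in> hcoords x" "q \<noteq> 0" and "finite Y"
    and sep: "separates (mform j (j - 1) q) Y" and "2 \<le> j"
    and S: "S = {F. homogeneous j F \<and> (\<forall>p\<in>Y. poly3_eval F p = 0)}"
  shows "poly3_dim {F \<in> S. vanishes_to_order (j - 1) F x} + (j choose 2) \<le> poly3_dim S"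
proof -
  obtain i where i: "q $ i \<noteq> 0" using q(2) by (auto simp: vec_eq_iff)
  \<comment> \<open>The representative of the point that lies in the chart
    \<open>x_i = 1\<close>.\<close>
  define v where "v = (1 / q $ i) *s q"
  have v: "v $ i = 1" "v \<in> hcoords x" using i q(1) by (simp_all add: v_def)
  obtain M ks c where M: "\<And>a b. a + b \<le> j \<Longrightarrow> homogeneous j (M a b)"
    and c: "\<And>a b. a + b \<le> j \<Longrightarrow> c a b \<noteq> (0 :: complex)"
    and ks: "\<And>a b. a + b \<le> j \<Longrightarrow> length (ks a b) = a + b \<and> i \<notin> set (ks a b)"
    and Mks: "\<And>a b a' b'. a + b \<le> j \<Longrightarrow> poly3_eval (foldr partial_deriv (ks a b) (M a' b')) v =
       (if a = a' \<and> b = b' then c a b else 0)"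
    using exists_taylor_forms[OF v(1), of j] by blast
  obtain E where "\<forall>p\<in>Y. homogeneous j (E p) \<and> (\<forall>c. vanish_ord (j - 1) (E p) (c *s q)) \<and>
    (\<forall>p'\<in>Y. poly3_eval (E p) p' = (if p = p' then 1 else 0))"
    using separating_polynomials[OF sep] by blast
  then have E: "\<And>p. p \<in> Y \<Longrightarrow> homogeneous j (E p)"
    "\<And>p c. p \<in> Y \<Longrightarrow> vanish_ord (j - 1) (E p) (c *s q)"
    "\<And>p p'. p \<in> Y \<Longrightarrow> p' \<in> Y \<Longrightarrow> poly3_eval (E p) p' = (if p = p' then 1 else 0)"
    by simp_all
  \<comment> \<open>Orders below \<open>j - 1\<close> in two local coordinates:
    \<open>j choose 2\<close> pairs of exponents.\<close>
  define K where "K = {(a :: nat, b). a + b \<le> j - 2}"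
  define \<phi> where "\<phi> = (\<lambda>(a, b) F. poly3_eval (foldr partial_deriv (ks a b) F) v / c a b)"
  \<comment> \<open>The forms \<open>E p\<close> cancel the values of the Taylor monomial on
    \<open>Y\<close>. Vanishing to order \<open>j - 1\<close> at \<open>q\<close>, they leave the
    Taylor coefficients indexed by \<open>K\<close> unchanged.\<close>
  define G where "G = (\<lambda>(a, b). M a b + (\<Sum>p\<in>Y. poly3_scale (- poly3_eval (M a b) p) (E p)))"
  have add: "\<phi> k (F + F') = \<phi> k F + \<phi> k F'" for k F F'
    by (cases k) (simp add: \<phi>_def foldr_partial_deriv_add poly3_eval_add add_divide_distrib)
  have scale: "\<phi> k (poly3_scale a F) = a * \<phi> k F" for k a F
    by (cases k) (simp add: \<phi>_def foldr_partial_deriv_scale poly3_eval_scale)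
  have sum0: "\<phi> k (\<Sum>p\<in>Y'. f p) = 0" if "\<And>p. p \<in> Y' \<Longrightarrow> \<phi> k (f p) = 0" for k f and Y' :: "(complex ^ 3) set"
    using that scale[of k 0 0] by (induction Y' rule: infinite_finite_induct) (auto simp: add)
  obtain T where T: "finite T" "{F. homogeneous j F} \<subseteq> poly3.span T"
    using homogeneous_subset_span by blast
  have "poly3_dim {F \<in> S. vanishes_to_order (j - 1) F x} + card K \<le> poly3_dim S"
  proof (rule poly3_dim_add_card_le[where G = G and \<phi> = \<phi>, OF _ T(1) _ _ _ add scale])
    show "S \<subseteq> poly3.span T" using T(2) S by blast
    show "finite K" unfolding K_def by (rule finite_pairs_sum_le)
  next
    fix k assume "k \<in> K"
    then obtain a b where k: "k = (a, b)" "a + b \<le> j" by (auto simp: K_def)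
    have "poly3_eval (\<Sum>p\<in>Y. poly3_scale (- poly3_eval (M a b) p) (E p)) p' = - poly3_eval (M a b) p'"
      if "p' \<in> Y" for p'
    proof -
      have "poly3_eval (\<Sum>p\<in>Y. poly3_scale (- poly3_eval (M a b) p) (E p)) p' =
          (\<Sum>p\<in>Y. if p = p' then - poly3_eval (M a b) p' else 0)"
        unfolding poly3_eval_sum poly3_eval_scale using that E(3) by (intro sum.cong) auto
      with that \<open>finite Y\<close> show ?thesis by simp
    qed
    then show "G k \<in> S"
      using M k E(1) unfolding S G_def
      by (auto simp: poly3_eval_add simp del: poly3.scale_minus_left
          intro!: homogeneous_add homogeneous_sum homogeneous_scale)
  next
    fix k F assume "k \<in> K" "F \<in> {F \<in> S. vanishes_to_order (j - 1) F x}"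
    moreover obtain a b where k: "k = (a, b)" by fastforce
    ultimately show "\<phi> k F = 0"
      using ks[of a b] v \<open>2 \<le> j\<close> unfolding vanishes_to_order_def by (auto simp: \<phi>_def K_def)
  next
    fix k k' assume "k \<in> K" "k' \<in> K"
    moreover obtain a b a' b' where k: "k = (a, b)" "k' = (a', b')" by fastforce
    ultimately have ab: "a + b \<le> j" "a + b < j - 1" "a' + b' \<le> j" using \<open>2 \<le> j\<close> by (auto simp: K_def)
    have "\<phi> k (poly3_scale r (E p)) = 0" if "p \<in> Y" for r p
    proof -
      have "poly3_eval (foldr partial_deriv (ks a b) (E p)) v = 0"
        unfolding v_def using vanish_ord_foldr[OF E(2)[OF that]] ks[of a b] ab by simp
      then show ?thesis unfolding scale by (simp add: \<phi>_def k)
    qed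
    then have "\<phi> k (G k') = \<phi> k (M a' b')"
      unfolding G_def k(2) prod.case add using sum0[of Y k] by (simp del: poly3.scale_minus_left)
    also have "\<dots> = (if k = k' then 1 else 0)"
      using Mks[OF ab(1), of a' b'] c[OF ab(1)] by (auto simp: \<phi>_def k)
    finally show "\<phi> k (G k') = (if k = k' then 1 else 0)" .
  qed blast
  moreover have "card K = j choose 2"
    unfolding K_def card_pairs_sum_le using \<open>2 \<le> j\<close> by (simp only: le_add_diff_inverse2)
  ultimately show ?thesis by simp
qed

text \<open>The evaluations at \<open>Y\<close> are dual to the separating forms, so each point
  lowers the dimension by one.\<close>

lemma poly3_dim_vanishing_le:
  assumes "finite Y" and sep: "separates (mform j m q) Y"
    and S: "S = {F. homogeneous j F \<and> (\<forall>p\<in>Y. poly3_eval F p = 0)}"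
  shows "poly3_dim S + card Y \<le> (j + 2) choose 2"
proof -
  obtain E where "\<forall>p\<in>Y. homogeneous j (E p) \<and> (\<forall>c. vanish_ord m (E p) (c *s q)) \<and>
    (\<forall>p'\<in>Y. poly3_eval (E p) p' = (if p = p' then 1 else 0))"
    using separating_polynomials[OF sep] by blast
  then have E: "\<And>p. p \<in> Y \<Longrightarrow> homogeneous j (E p)"
    "\<And>p p'. p \<in> Y \<Longrightarrow> p' \<in> Y \<Longrightarrow> poly3_eval (E p) p' = (if p = p' then 1 else 0)"
    by simp_all
  obtain T where T: "finite T" "card T \<le> (j + 2) choose 2" "{F. homogeneous j F} \<subseteq> poly3.span T"
    using homogeneous_subset_span by blast
  have "poly3_dim S + card Y \<le> poly3_dim {F. homogeneous j F}"
    by (rule poly3_dim_add_card_le[where G = E and \<phi> = "\<lambda>p F. poly3_eval F p" and T = T])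
       (use T E assms in \<open>auto simp: poly3_eval_add poly3_eval_scale\<close>)
  also have "\<dots> \<le> card T" using T by (intro poly3.dim_le_card)
  finally show ?thesis using T(2) by simp
qed

text \<open>A fixed degree makes the spaces finite-dimensional; the estimate is then the case of an
  empty family of functionals.\<close>

lemma poly3_dim_mono:
  assumes "V \<subseteq> S" "\<And>F. F \<in> S \<Longrightarrow> homogeneous j F"
  shows "poly3_dim V \<le> poly3_dim S"
proof -
  obtain T where T: "finite T" "{F. homogeneous j F} \<subseteq> poly3.span T"
    using homogeneous_subset_span by blast
  with assms(2) have "S \<subseteq> poly3.span T" by blast
  from poly3_dim_add_card_le[OF assms(1) T(1) this, of "{}" undefined "\<lambda>_ _. 0"] show ?thesis by simp
qed

section \<open>Points of the projective plane\<close>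

lemma hcoords_eq:
  assumes "u \<in> hcoords p"
  shows "hcoords p = {c *s u | c. c \<noteq> 0}" "line_of p = vec.span {u}" "u \<noteq> 0"
proof -
  obtain w where w: "w \<noteq> 0" "line_of p = vec.span {w}" using line_of[of p] by blast
  have u: "u \<noteq> 0" "u \<in> vec.span {w}" using assms w by (auto simp: hcoords_def)
  then obtain a where a: "u = a *s w" by (auto simp: vec.span_singleton)
  with u have "a \<noteq> 0" by auto
  then have "w = (1 / a) *s u" using a by (simp add: vector_smult_assoc)
  then have "w \<in> vec.span {u}" by (metis vec.span_base vec.span_scale insertI1)
  with u(2) show *: "line_of p = vec.span {u}" "u \<noteq> 0"
    unfolding w(2) using u(1) by (auto simp: vec.span_eq)
  then show "hcoords p = {c *s u | c. c \<noteq> 0}"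
    by (auto simp: hcoords_def vec.span_singleton)
qed

text \<open>Rescaling multiplies the value of a form by a nonzero factor, so one representative
  decides.\<close>

lemma vanishes_at_iff:
  assumes "homogeneous d F" "u \<in> hcoords p"
  shows "vanishes_at F p \<longleftrightarrow> poly3_eval F u = 0"
  using assms hcoords_eq[OF assms(2)] by (auto simp: vanishes_at_def poly3_eval_smult)

lemma hcoords_nonempty: "\<exists>u. u \<in> hcoords p"
  using line_of[of p] vec.span_base[of _ "{_}"] unfolding hcoords_def by fastforce

lemma exists_hcoords:
  assumes "q \<noteq> 0"
  shows "\<exists>x. q \<in> hcoords x"
proof -
  have "line_of (Proj_plane (vec.span {q})) = vec.span {q}"
    by (rule Proj_plane_inverse) (use assms in blast)
  moreover have "q \<in> vec.span {q}" by (simp add: vec.span_base)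
  ultimately show ?thesis using assms unfolding hcoords_def by blast
qed

theorem proposition3p6:
  fixes Z :: "proj_plane set"
  assumes "finite Z" and "card Z \<le> 8"
  shows "\<forall>j\<ge>2. \<not> admits_unexpected_curves Z j"
proof (intro allI impI notI)
  fix j :: nat assume j: "2 \<le> j" and "admits_unexpected_curves Z j"
  then obtain U where U: "zariski_open U" "U \<noteq> {}"
    and unexp: "\<And>q. q \<in> U \<Longrightarrow> int (poly3_dim (sections_through_mult j Z (j - 1) q)) >
         max 0 (int (poly3_dim (sections_through j Z)) - int (j choose 2))"
    unfolding admits_unexpected_curves_def for_generic_point_def by blast
  \<comment> \<open>A single form not vanishing everywhere already cuts out a nonempty open set
    inside \<open>U\<close>.\<close>
  obtain H e y where H: "homogeneous e H" "\<And>q. \<not> vanishes_at H q \<Longrightarrow> q \<in> U" "\<not> vanishes_at H y"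
    using U unfolding zariski_open_def by blast
  obtain u where u: "\<And>p. u p \<in> hcoords p" using hcoords_nonempty by metis
  have "distinct_points (u ` Z)"
    unfolding distinct_points_def
  proof (intro conjI ballI impI)
    show "0 \<notin> u ` Z" using u by (auto simp: hcoords_def)
  next
    fix a b assume "a \<in> u ` Z" "b \<in> u ` Z" "a \<noteq> b"
    then obtain p p' where p: "a = u p" "b = u p'" "p \<noteq> p'" by blast
    show "cr a b \<noteq> 0"
    proof
      assume "cr a b = 0"
      then obtain c where "u p' = c *s u p" using cr_eq_0_iff hcoords_eq(3)[OF u] p by blast
      moreover from this have "c \<noteq> 0" using hcoords_eq(3)[OF u, of p'] by auto
      ultimately have "u p' \<in> hcoords p" using hcoords_eq(1)[OF u, of p] by blast
      then have "line_of p = line_of p'" using hcoords_eq(2) u by metis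
      with p(3) show False by (simp add: line_of_inject)
    qed
  qed
  define W where "W = u ` Z"
  have W: "finite W" "distinct_points W" "card W \<le> 8"
    using assms card_image_le[of Z u] \<open>distinct_points (u ` Z)\<close> by (auto simp: W_def)
  have sections: "sections_through j Z = {F. homogeneous j F \<and> (\<forall>p\<in>W. poly3_eval F p = 0)}"
    using vanishes_at_iff u unfolding sections_through_def W_def by blast
  \<comment> \<open>Forms of degree \<open>j\<close> through \<open>Y\<close> are the same as forms
    through all of \<open>Z\<close>, and \<open>Y\<close> imposes independent conditions.\<close>
  obtain Y where Y: "Y \<subseteq> W" "separates (form j) Y"
    "\<forall>f\<in>form j. (\<forall>p\<in>Y. f p = 0) \<longrightarrow> (\<forall>p\<in>W. f p = 0)"
    using maximal_separated_subset[OF lin_closed_form W(1), of j] by blast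
  have "finite Y" using Y(1) W(1) by (rule finite_subset)
  \<comment> \<open>The bound \<open>2 * j + 1\<close> is the difference between
    \<open>(j + 2) choose 2\<close> and \<open>j choose 2\<close>, the number of points after which
    no form with the multiple point is expected.\<close>
  have "min (card Y) (2 * j + 1) \<le> card Y" by simp
  then obtain X where X: "X \<subseteq> Y" "card X = min (card Y) (2 * j + 1)"
    by (rule obtain_subset_with_card_n)
  have X': "finite X" "distinct_points X" "separates (form j) X" "card X \<le> 8" "card X \<le> 2 * j + 1"
  proof -
    show "finite X" using X(1) \<open>finite Y\<close> by (rule finite_subset)
    show "distinct_points X" using W(2) X(1) Y(1) unfolding distinct_points_def by blast
    show "separates (form j) X" using Y(2) X(1) by (rule separates_subset)
    have "card X \<le> card Y" using X(2) by simp
    also have "card Y \<le> card W" using W(1) Y(1) by (rule card_mono)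
    also have "card W \<le> 8" by (rule W(3))
    finally show "card X \<le> 8" .
    show "card X \<le> 2 * j + 1" using X(2) by simp
  qed
  obtain q\<^sub>0 where q0: "q\<^sub>0 \<noteq> 0" "separates (ext_mform j (j - 1) q\<^sub>0) X"
    using exists_separating_point[OF X'(1-3) j X'(4,5)] by blast
  have "poly3_eval H (u y) \<noteq> 0" using H vanishes_at_iff u by blast
  moreover have "poly3_eval H \<in> form e" using H(1) by (auto simp: form_def)
  \<comment> \<open>Separation passes from the special point to a point where \<open>H\<close> is
    nonzero, which therefore lies in \<open>U\<close>.\<close>
  ultimately obtain q where q: "q \<noteq> 0" "poly3_eval H q \<noteq> 0" "separates (mform j (j - 1) q) X"
    using separates_at_nonzero[OF q0(2) X'(1) q0(1)] by blast
  obtain x where x: "q \<in> hcoords x" using exists_hcoords[OF q(1)] by blast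
  have "x \<in> U" using q(2) H vanishes_at_iff x by blast
  define S where "S = {F. homogeneous j F \<and> (\<forall>p\<in>X. poly3_eval F p = 0)}"
  have dim1: "poly3_dim {F \<in> S. vanishes_to_order (j - 1) F x} + (j choose 2) \<le> poly3_dim S"
    using hcoords_eq(1)[OF x] q(1,3) j X'(1) by (intro poly3_dim_multiple_point_le[OF _ _ _ _ _ S_def]) auto
  have dim2: "poly3_dim S + card X \<le> (j + 2) choose 2"
    by (rule poly3_dim_vanishing_le[OF X'(1) q(3) S_def])
  have "sections_through_mult j Z (j - 1) x \<subseteq> {F \<in> S. vanishes_to_order (j - 1) F x}"
    using X(1) Y(1) unfolding sections_through_mult_def sections S_def by blast
  then have dim3: "poly3_dim (sections_through_mult j Z (j - 1) x) \<le>
      poly3_dim {F \<in> S. vanishes_to_order (j - 1) F x}"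
    by (rule poly3_dim_mono[where j = j]) (auto simp: S_def)
  show False
  proof (cases "card Y \<le> 2 * j + 1")
    case True
    \<comment> \<open>Nothing was cut off, so \<open>S\<close> consists of all forms through
      \<open>Z\<close> and the multiple point lowers its dimension by at least
      \<open>j choose 2\<close>.\<close>
    then have "X = Y" using X \<open>finite Y\<close> by (intro card_subset_eq) auto
    have "S = sections_through j Z"
      unfolding S_def sections \<open>X = Y\<close> using Y(1,3) unfolding form_def by blast
    then show False using dim1 dim3 unexp[OF \<open>x \<in> U\<close>] by simp
  next
    case False
    \<comment> \<open>Now \<open>S\<close> has dimension at most \<open>j choose 2\<close>, so no
      nonzero form through \<open>Z\<close> has the multiple point at \<open>x\<close>, against
      strict positivity.\<close>
    then have "card X = 2 * j + 1" using X(2) by simp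
    moreover have "(j + 2) choose 2 = (j choose 2) + (2 * j + 1)"
      by (simp add: numeral_2_eq_2)
    ultimately show False using dim1 dim2 dim3 unexp[OF \<open>x \<in> U\<close>] by simp
  qed
qed

end
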